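(* Let $(\Gamma,\gamma)$ be a spin network with $\Gamma=(G,R)$, let $\mathcal O$ be a smooth orientation of $G$ and $\tau$ a gate signage. Then there is a sign $\mu\in\{+1,-1\}$ (depending on the data $\Gamma,\gamma,\mathcal O,\tau$) such that $$\langle\Gamma,\gamma\rangle^P=\mu\Big(\prod_{e\in E(G)}\gamma(e)!\Big)\langle G,\mathcal O,\tau,\gamma\rangle^{CG}.$$
   Context: A cubic ribbon graph $\Gamma=(G,R)$: $G$ a finite graph with all vertices of degree $3$ (multiple edges and loops allowed, a loop counting $2$; possibly disconnected; possibly with trivial components, i.e. single edges closing on themselves with no vertex), $R$ a cyclic ordering of half-edges at each vertex, giving an embedding in a closed orientable surface. A decoration $\gamma:E(G)\to\{0,1,\dots\}$ is admissible if at each vertex with incident decorations $a,b,c$ (loop counted twice) $a+b+c$ is even and $|a-b|\le c\le a+b$. Penrose evaluation: replace each edge $e$ by $\gamma(e)$ parallel strands on the thickened embedded graph; at each vertex join strands without crossings, $\frac{a+b-c}{2}$ between the $a$- and $b$-edges, $\frac{a+c-b}{2}$ between $a,c$, $\frac{b+c-a}{2}$ between $b,c$; insert $\sigma_e\in\mathfrak S_{\gamma(e)}$ on each edge; $\langle\Gamma,\gamma\rangle^P=\sum_{\vec\sigma}(\prod_e\mathrm{sign}\,\sigma_e)(-2)^{N(\vec\sigma)}$, $N(\vec\sigma)$ the number of closed curves. A smooth orientation $\mathcal O$ orients the edges of $G$ so that every vertex has (indegree, outdegree) equal to $(1,2)$ or $(2,1)$. At each vertex the two half-edges with the same direction relative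 to the vertex form the gate; a gate signage $\tau$ chooses, at every vertex, an ordering $(h_1,h_2)$ of the gate half-edges; let $h_0$ be the third half-edge. CG evaluation: with $\epsilon_{11}=\epsilon_{22}=0$, $\epsilon_{12}=1$, $\epsilon_{21}=-1$, for a vertex $v$ with $a=\gamma(h_1)$, $b=\gamma(h_2)$, $c=\gamma(h_0)$, $p=\frac{a+b-c}{2}$, $q=\frac{a+c-b}{2}$, $r=\frac{b+c-a}{2}$, define for $I\in\{1,2\}^a,J\in\{1,2\}^b,K\in\{1,2\}^c$: $T_v(I,J,K)=\prod_{t=1}^p\epsilon_{I_tJ_t}\prod_{t=1}^q\delta_{I_{p+t}K_t}\prod_{t=1}^r\delta_{J_{p+t}K_{q+t}}$, and $W_v(I,J,K)=\frac{1}{a!b!c!}\sum_{\alpha\in\mathfrak S_a,\beta\in\mathfrak S_b,\kappa\in\mathfrak S_c}T_v(I\circ\alpha,J\circ\beta,K\circ\kappa)$. Then $\langle G,\mathcal O,\tau,\gamma\rangle^{CG}=\sum_{x}\prod_v W_v(x_{h_1},x_{h_2},x_{h_0})$, the sum over all assignments $x$ of a multi-index $x_e\in\{1,2\}^{\gamma(e)}$ to each edge $e$ (each half-edge using the multi-index of its edge), times a factor $a+1$ for each trivial component with decoration $a$ (a trivial component's single edge is oriented arbitrarily). *)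

theory Defs
  imports Complex_Main "HOL-Combinatorics.Permutations" "HOL-Library.FuncSet"
begin

section \<open>Cubic ribbon graphs as combinatorial maps\<close>

text \<open>Half-edges (darts) form a finite set H. The involution iota pairs the two
 half-edges of an edge (fixed-point free), the permutation rho is the cyclic ordering
 at the vertices; every rho-orbit has exactly 3 elements (cubic). Loops and multiple
 edges are allowed. Trivial components (edges without vertices) are recorded
 separately as a list of their decorations.\<close>

definition cubic_ribbon_graph :: "'d set \<Rightarrow> ('d \<Rightarrow> 'd) \<Rightarrow> ('d \<Rightarrow> 'd) \<Rightarrow> bool" where
  "cubic_ribbon_graph H \<iota> \<rho> \<longleftrightarrow> finite H \<and> \<iota> permutes H \<and>
     (\<forall>h\<in>H. \<iota> (\<iota> h) = h \<and> \<iota> h \<noteq> h) \<and>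
     \<rho> permutes H \<and> (\<forall>h\<in>H. \<rho> h \<noteq> h \<and> \<rho> (\<rho> (\<rho> h)) = h)"

definition edge_of :: "('d \<Rightarrow> 'd) \<Rightarrow> 'd \<Rightarrow> 'd set" where
  "edge_of \<iota> h = {h, \<iota> h}"

definition edges :: "'d set \<Rightarrow> ('d \<Rightarrow> 'd) \<Rightarrow> 'd set set" where
  "edges H \<iota> = edge_of \<iota> ` H"

definition vertex_of :: "('d \<Rightarrow> 'd) \<Rightarrow> 'd \<Rightarrow> 'd set" where
  "vertex_of \<rho> h = {h, \<rho> h, \<rho> (\<rho> h)}"

definition vertices :: "'d set \<Rightarrow> ('d \<Rightarrow> 'd) \<Rightarrow> 'd set set" where
  "vertices H \<rho> = vertex_of \<rho> ` H"

text \<open>A decoration gamma assigns a natural number to each edge (a set of two darts);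
 hdec is the induced decoration of a half-edge.\<close>

definition hdec :: "('d \<Rightarrow> 'd) \<Rightarrow> ('d set \<Rightarrow> nat) \<Rightarrow> 'd \<Rightarrow> nat" where
  "hdec \<iota> \<gamma> h = \<gamma> (edge_of \<iota> h)"

definition admissible :: "'d set \<Rightarrow> ('d \<Rightarrow> 'd) \<Rightarrow> ('d \<Rightarrow> 'd) \<Rightarrow> ('d set \<Rightarrow> nat) \<Rightarrow> bool" where
  "admissible H \<iota> \<rho> \<gamma> \<longleftrightarrow> (\<forall>h\<in>H.
     let a = hdec \<iota> \<gamma> h; b = hdec \<iota> \<gamma> (\<rho> h); c = hdec \<iota> \<gamma> (\<rho> (\<rho> h)) in
     even (a + b + c) \<and> \<bar>int a - int b\<bar> \<le> int c \<and> c \<le> a + b)"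

section \<open>Penrose evaluation\<close>

text \<open>Strand endpoints: (h, i) is the i-th strand (0-based, in the counterclockwise order
 around the vertex of h) of the half-edge h.\<close>

definition strand_points :: "'d set \<Rightarrow> ('d \<Rightarrow> 'd) \<Rightarrow> ('d set \<Rightarrow> nat) \<Rightarrow> ('d \<times> nat) set" where
  "strand_points H \<iota> \<gamma> = {(h, i). h \<in> H \<and> i < hdec \<iota> \<gamma> h}"

text \<open>Non-crossing joining at a vertex with counterclockwise half-edges h, rho h, rho (rho h)
 of decorations a, b, c: the last (a+b-c)/2 strands of h go to the first ones of rho h
 (nested), the first (a+c-b)/2 strands of h go to the last ones of rho (rho h) (nested).\<close>

definition vertex_match :: "('d \<Rightarrow> 'd) \<Rightarrow> ('d \<Rightarrow> 'd) \<Rightarrow> ('d set \<Rightarrow> nat) \<Rightarrow> 'd \<times> nat \<Rightarrow> 'd \<times> nat" where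
  "vertex_match \<iota> \<rho> \<gamma> x = (case x of (h, i) \<Rightarrow>
     let a = hdec \<iota> \<gamma> h; b = hdec \<iota> \<gamma> (\<rho> h); c = hdec \<iota> \<gamma> (\<rho> (\<rho> h)) in
     if i < (a + c - b) div 2 then (\<rho> (\<rho> h), c - 1 - i) else (\<rho> h, a - 1 - i))"

definition edge_rep :: "'d set \<Rightarrow> 'd" where
  "edge_rep e = (SOME h. h \<in> e)"

text \<open>Along the ribbon of an edge e the strand order is reversed; the permutation sigma e
 is inserted, read from the representative half-edge of e to the other one.\<close>

definition edge_match :: "('d \<Rightarrow> 'd) \<Rightarrow> ('d set \<Rightarrow> nat) \<Rightarrow> ('d set \<Rightarrow> nat \<Rightarrow> nat) \<Rightarrow> 'd \<times> nat \<Rightarrow> 'd \<times> nat" where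
  "edge_match \<iota> \<gamma> \<sigma> x = (case x of (h, i) \<Rightarrow>
     let e = edge_of \<iota> h; g = \<gamma> e in
     if h = edge_rep e then (\<iota> h, g - 1 - \<sigma> e i) else (\<iota> h, inv (\<sigma> e) (g - 1 - i)))"

definition curve_rel :: "'d set \<Rightarrow> ('d \<Rightarrow> 'd) \<Rightarrow> ('d \<Rightarrow> 'd) \<Rightarrow> ('d set \<Rightarrow> nat)
    \<Rightarrow> ('d set \<Rightarrow> nat \<Rightarrow> nat) \<Rightarrow> (('d \<times> nat) \<times> ('d \<times> nat)) set" where
  "curve_rel H \<iota> \<rho> \<gamma> \<sigma> =
     {(x, vertex_match \<iota> \<rho> \<gamma> x) | x. x \<in> strand_points H \<iota> \<gamma>} \<union>
     {(x, edge_match \<iota> \<gamma> \<sigma> x) | x. x \<in> strand_points H \<iota> \<gamma>}"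

text \<open>Number of closed curves of the non-trivial part: connected components of the strand graph.\<close>

definition graph_curves :: "'d set \<Rightarrow> ('d \<Rightarrow> 'd) \<Rightarrow> ('d \<Rightarrow> 'd) \<Rightarrow> ('d set \<Rightarrow> nat)
    \<Rightarrow> ('d set \<Rightarrow> nat \<Rightarrow> nat) \<Rightarrow> nat" where
  "graph_curves H \<iota> \<rho> \<gamma> \<sigma> = card (strand_points H \<iota> \<gamma> // (curve_rel H \<iota> \<rho> \<gamma> \<sigma>)\<^sup>*)"

text \<open>Closed curves on a trivial component with a strands and permutation pi: cycles of pi.\<close>

definition perm_cycles :: "nat \<Rightarrow> (nat \<Rightarrow> nat) \<Rightarrow> nat" where
  "perm_cycles n \<pi> = card ({..<n} // ({(i, \<pi> i) | i. i < n} \<union> {(\<pi> i, i) | i. i < n})\<^sup>*)"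

definition perms_of :: "nat \<Rightarrow> (nat \<Rightarrow> nat) set" where
  "perms_of n = {\<pi>. \<pi> permutes {..<n}}"

definition penrose :: "'d set \<Rightarrow> ('d \<Rightarrow> 'd) \<Rightarrow> ('d \<Rightarrow> 'd) \<Rightarrow> ('d set \<Rightarrow> nat) \<Rightarrow> nat list \<Rightarrow> int" where
  "penrose H \<iota> \<rho> \<gamma> tc =
     (\<Sum>\<sigma>\<in>(\<Pi>\<^sub>E e\<in>edges H \<iota>. perms_of (\<gamma> e)).
      \<Sum>\<tau>\<in>(\<Pi>\<^sub>E k\<in>{..<length tc}. perms_of (tc ! k)).
        (\<Prod>e\<in>edges H \<iota>. sign (\<sigma> e)) * (\<Prod>k<length tc. sign (\<tau> k)) *
        (-2) ^ (graph_curves H \<iota> \<rho> \<gamma> \<sigma> + (\<Sum>k<length tc. perm_cycles (tc ! k) (\<tau> k))))"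

section \<open>Smooth orientations, gates, gate signages\<close>

text \<open>An orientation is encoded by out h = "the edge of h points away from the vertex of h".\<close>

definition smooth_orientation :: "'d set \<Rightarrow> ('d \<Rightarrow> 'd) \<Rightarrow> ('d \<Rightarrow> 'd) \<Rightarrow> ('d \<Rightarrow> bool) \<Rightarrow> bool" where
  "smooth_orientation H \<iota> \<rho> out \<longleftrightarrow>
     (\<forall>h\<in>H. out (\<iota> h) \<longleftrightarrow> \<not> out h) \<and>
     (\<forall>h\<in>H. \<not> (out h = out (\<rho> h) \<and> out (\<rho> h) = out (\<rho> (\<rho> h))))"

definition gate :: "('d \<Rightarrow> bool) \<Rightarrow> 'd set \<Rightarrow> 'd set" where
  "gate out v = {h \<in> v. \<exists>h'\<in>v. h' \<noteq> h \<and> out h' = out h}"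

definition gate_signage :: "'d set \<Rightarrow> ('d \<Rightarrow> 'd) \<Rightarrow> ('d \<Rightarrow> bool) \<Rightarrow> ('d set \<Rightarrow> 'd \<times> 'd) \<Rightarrow> bool" where
  "gate_signage H \<rho> out \<tau> \<longleftrightarrow> (\<forall>v\<in>vertices H \<rho>.
     fst (\<tau> v) \<in> gate out v \<and> snd (\<tau> v) \<in> gate out v \<and> fst (\<tau> v) \<noteq> snd (\<tau> v))"

definition third_he :: "('d \<Rightarrow> bool) \<Rightarrow> 'd set \<Rightarrow> 'd" where
  "third_he out v = (THE h. h \<in> v - gate out v)"

section \<open>Clebsch--Gordan evaluation\<close>

definition eps :: "nat \<Rightarrow> nat \<Rightarrow> real" where
  "eps i j = (if i = 1 \<and> j = 2 then 1 else if i = 2 \<and> j = 1 then -1 else 0)"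

definition kdelta :: "nat \<Rightarrow> nat \<Rightarrow> real" where
  "kdelta i j = (if i = j then 1 else 0)"

text \<open>Multi-indices are 0-based: I t for t < a.\<close>

definition T_v :: "nat \<Rightarrow> nat \<Rightarrow> nat \<Rightarrow> (nat \<Rightarrow> nat) \<Rightarrow> (nat \<Rightarrow> nat) \<Rightarrow> (nat \<Rightarrow> nat) \<Rightarrow> real" where
  "T_v a b c I J K = (let p = (a + b - c) div 2; q = (a + c - b) div 2; r = (b + c - a) div 2 in
     (\<Prod>t<p. eps (I t) (J t)) * (\<Prod>t<q. kdelta (I (p + t)) (K t)) *
     (\<Prod>t<r. kdelta (J (p + t)) (K (q + t))))"

definition W_v :: "nat \<Rightarrow> nat \<Rightarrow> nat \<Rightarrow> (nat \<Rightarrow> nat) \<Rightarrow> (nat \<Rightarrow> nat) \<Rightarrow> (nat \<Rightarrow> nat) \<Rightarrow> real" where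
  "W_v a b c I J K = 1 / (fact a * fact b * fact c) *
     (\<Sum>\<alpha>\<in>perms_of a. \<Sum>\<beta>\<in>perms_of b. \<Sum>\<kappa>\<in>perms_of c. T_v a b c (I \<circ> \<alpha>) (J \<circ> \<beta>) (K \<circ> \<kappa>))"

definition multi_indices :: "nat \<Rightarrow> (nat \<Rightarrow> nat) set" where
  "multi_indices n = (\<Pi>\<^sub>E t\<in>{..<n}. {1, 2})"

definition cg_eval :: "'d set \<Rightarrow> ('d \<Rightarrow> 'd) \<Rightarrow> ('d \<Rightarrow> 'd) \<Rightarrow> ('d set \<Rightarrow> nat) \<Rightarrow> nat list
    \<Rightarrow> ('d \<Rightarrow> bool) \<Rightarrow> ('d set \<Rightarrow> 'd \<times> 'd) \<Rightarrow> real" where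
  "cg_eval H \<iota> \<rho> \<gamma> tc out \<tau> =
     (\<Sum>x\<in>(\<Pi>\<^sub>E e\<in>edges H \<iota>. multi_indices (\<gamma> e)).
        \<Prod>v\<in>vertices H \<rho>.
          (let h1 = fst (\<tau> v); h2 = snd (\<tau> v); h0 = third_he out v in
           W_v (hdec \<iota> \<gamma> h1) (hdec \<iota> \<gamma> h2) (hdec \<iota> \<gamma> h0)
               (x (edge_of \<iota> h1)) (x (edge_of \<iota> h2)) (x (edge_of \<iota> h0))))
     * (\<Prod>k<length tc. real (tc ! k + 1))"

end

theory Submission
  imports Defs
begin

text \<open>Both evaluations are state sums over closed strand curves. Fix the permutations on the edges
  and let \<open>P\<close> be the set of strand ends, matched by the vertex joining \<open>V\<close> and the edge joining
  \<open>E\<close>. A choice of direction on every closed curve is a set \<open>S \<subseteq> P\<close> that \<open>V\<close> and \<open>E\<close> both exchange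
  with its complement, so \<open>2 ^ N\<close> counts such sets. Comparing the direction with the smooth
  orientation turns \<open>S\<close> into a colouring by 1 and 2 that is constant along edges, and these
  are exactly the colourings to which the tensors \<open>T\<close> give a nonzero weight: colours change
  precisely at the arcs inside a gate, where the orientation turns. The weight is a product of
  signs, one for each turning arc.

  On the other side \<open>(-1) ^ N\<close> is, up to a constant, the sign of the permutation of \<open>P\<close> that
  traverses all curves in the direction \<open>S\<close>. The product of this sign, the signs of the edge
  permutations and the turning signs does not depend on \<open>S\<close> or \<open>E\<close>: one can pass between any two
  such pairs by reversing the direction of one arc of \<open>V\<close> at a time and repairing \<open>E\<close> by
  transpositions. A trivial component contributes the sum of \<open>sign \<pi> * (-2) ^ cycles\<close> over the
  permutations of its \<open>n\<close> strands, which is \<open>(-1) ^ n * (n + 1)!\<close>.\<close>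

section \<open>Signs and cycle counts\<close>

text \<open>The sign has to be the same for all edge permutations at once, although the available
  directions S change with the permutations. For a common S, two edge joinings E and F differ by
  \<open>F \<circ> E\<close>, which preserves S and the set X of outgoing ends; it affects the
  traversal through S and the edge permutations through X, and both signs change by the same factor.
  For different S, an arc that turns inside a gate is reversed by conjugating with the transposition
  of its two ends. This would violate the orientation for an arc between the gate and the third
  half-edge, so there the edge joining is cut and rejoined. The factorials come from averaging over
  one permutation per half-edge, so each edge e contributes 1 / (\<gamma> e)!^2. Renaming the
  multi-index of e absorbs one of its two permutations; what remains is (\<gamma> e)! equal copies
  of a sum over one permutation, hence a net 1 / (\<gamma> e)!. For a trivial component the identity
  is (n + 1)! = n! * (n + 1).\<close>

lemma sign_on_Un:
  assumes "finite A" "finite B" "A \<inter> B = {}" "bij_betw f A A" "bij_betw f B B"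
  shows "sign_on (A \<union> B) f = sign_on A f * sign_on B f"
proof -
  have "restrict_id f (A \<union> B) = restrict_id f A \<circ> restrict_id f B"
    using assms by (auto simp: fun_eq_iff restrict_id_def bij_betw_def)
  moreover have "permutation (restrict_id f A)" "permutation (restrict_id f B)"
    using assms permutes_restrict_id permutes_imp_permutation by metis+
  ultimately show ?thesis
    by (simp add: sign_on_def sign_compose)
qed

text \<open>The two maps need to correspond only on A and B. This allows transport between different
  sets, such as the two halves of the strand ends.\<close>

lemma sign_on_conjugate:
  assumes "finite A" "bij_betw h A B" "bij_betw f A A" "\<And>x. x \<in> A \<Longrightarrow> g (h x) = h (f x)"
  shows "sign_on B g = sign_on A f"
proof -
  have inj: "inj_on h A" and B: "B = h ` A"
    using assms(2) by (auto simp: bij_betw_def)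
  have p: "restrict_id f A permutes A"
    using assms(3) by (rule permutes_restrict_id)
  have "map_permutation A h (restrict_id f A) = restrict_id g B"
  proof
    fix y
    show "map_permutation A h (restrict_id f A) y = restrict_id g B y"
    proof (cases "y \<in> B")
      case True
      then obtain x where "x \<in> A" "y = h x" using B by auto
      then show ?thesis
        using True assms(4) by (simp add: map_permutation_apply[OF inj])
    next
      case False
      then show ?thesis by (simp add: map_permutation_def B)
    qed
  qed
  then show ?thesis
    using sign_map_permutation[OF inj p assms(1)] by (simp add: sign_on_def)
qed

lemma sign_on_inverse:
  assumes "finite A" "bij_betw f A A" "\<And>x. x \<in> A \<Longrightarrow> g x \<in> A \<and> f (g x) = x"
  shows "sign_on A g = sign_on A f"
proof -
  have inj: "inj_on f A" using assms(2) by (simp add: bij_betw_def)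
  have "f x \<in> A" if "x \<in> A" for x using assms(2) that by (auto simp: bij_betw_def)
  then have "bij_betw g A A"
    by (intro bij_betw_byWitness[where f' = f]) (use assms(3) inj in \<open>auto dest: inj_onD\<close>)
  then have "sign_on A f * sign_on A g = sign_on A (f \<circ> g)"
    using assms by (intro sign_on_compose[symmetric]) auto
  also have "\<dots> = sign_on A id"
    using assms(3) by (intro sign_on_cong) auto
  finally have "sign_on A f * sign_on A g = 1" by simp
  then have "sign_on A f * (sign_on A f * sign_on A g) = sign_on A f" by simp
  then show ?thesis by (simp add: sign_on_def)
qed

text \<open>Invariant sets stand in for cycles: a permutation with \<open>n\<close> cycles has \<open>2 ^ n\<close> of them.\<close>

definition invariant_sets :: "('a \<Rightarrow> 'a) \<Rightarrow> 'a set \<Rightarrow> 'a set set" where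
  "invariant_sets p A = {B. B \<subseteq> A \<and> (\<forall>x\<in>A. p x \<in> B \<longleftrightarrow> x \<in> B)}"

lemma finite_invariant_sets: "finite A \<Longrightarrow> finite (invariant_sets p A)"
  by (rule finite_subset[of _ "Pow A"]) (auto simp: invariant_sets_def)

text \<open>For b = a the point a becomes a new cycle, which can be put into an invariant set or
  left out. Otherwise a is inserted into the cycle of b, just before b, and the number of cycles
  does not change.\<close>

lemma card_invariant_sets_insert:
  assumes "finite S" "a \<notin> S" "q permutes S" "b \<in> insert a S"
  shows "card (invariant_sets (transpose a b \<circ> q) (insert a S)) =
    (if b = a then 2 else 1) * card (invariant_sets q S)"
proof (cases "b = a")
  case True
  have qa: "q a = a" using assms by (simp add: permutes_not_in)
  have qS: "q x \<in> S \<longleftrightarrow> x \<in> S" for x using assms(3) by (rule permutes_in_image)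
  have "invariant_sets (transpose a b \<circ> q) (insert a S) =
      invariant_sets q S \<union> insert a ` invariant_sets q S" (is "?L = ?R")
  proof (intro set_eqI iffI)
    fix B assume B: "B \<in> ?L"
    show "B \<in> ?R"
    proof (cases "a \<in> B")
      case True
      then have "B = insert a (B - {a})" by auto
      moreover have "B - {a} \<in> invariant_sets q S"
        using B \<open>b = a\<close> assms(2) qS by (auto simp: invariant_sets_def)
      ultimately show ?thesis by blast
    next
      case False
      then have "B \<in> invariant_sets q S"
        using B \<open>b = a\<close> by (auto simp: invariant_sets_def)
      then show ?thesis by blast
    qed
  next
    fix B assume "B \<in> ?R"
    then show "B \<in> ?L"
      using \<open>b = a\<close> qa qS assms(2) by (auto simp: invariant_sets_def)
  qed
  moreover have "invariant_sets q S \<inter> insert a ` invariant_sets q S = {}"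
    using assms(2) by (auto simp: invariant_sets_def)
  moreover have "inj_on (insert a) (invariant_sets q S)"
    using assms(2) by (auto simp: invariant_sets_def inj_on_def)
  ultimately show ?thesis
    using True finite_invariant_sets[OF assms(1)] by (simp add: card_Un_disjoint card_image)
next
  case False
  then have bS: "b \<in> S" using assms by auto
  define p where "p = transpose a b \<circ> q"
  have qa: "q a = a" using assms by (simp add: permutes_not_in)
  have pa: "p a = b" by (simp add: p_def qa)
  have qS: "q x \<in> S \<longleftrightarrow> x \<in> S" for x using assms(3) by (rule permutes_in_image)
  have px: "p x = (if q x = b then a else q x)" if "x \<in> S" for x
    using that qS[of x] assms(2) by (auto simp: p_def transpose_def)
  \<comment> \<open>Since \<open>p a = b\<close>, membership of a in an invariant set is dictated by
    b; deleting a loses no information.\<close>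
  have "bij_betw (\<lambda>B. B - {a}) (invariant_sets p (insert a S)) (invariant_sets q S)"
  proof (rule bij_betw_byWitness[where f' = "\<lambda>B. if b \<in> B then insert a B else B"])
    show "\<forall>B\<in>invariant_sets p (insert a S).
        (if b \<in> B - {a} then insert a (B - {a}) else B - {a}) = B"
      using False pa by (auto simp: invariant_sets_def)
    show "\<forall>B\<in>invariant_sets q S. (if b \<in> B then insert a B else B) - {a} = B"
      using assms(2) by (auto simp: invariant_sets_def)
    show "(\<lambda>B. B - {a}) ` invariant_sets p (insert a S) \<subseteq> invariant_sets q S"
    proof clarify
      fix B assume B: "B \<in> invariant_sets p (insert a S)"
      have ab: "a \<in> B \<longleftrightarrow> b \<in> B" using B pa by (auto simp: invariant_sets_def)
      have "q x \<in> B \<longleftrightarrow> x \<in> B" if "x \<in> S" for x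
      proof -
        have "p x \<in> B \<longleftrightarrow> x \<in> B" using B that by (auto simp: invariant_sets_def)
        then show ?thesis using px[OF that] ab by (auto split: if_splits)
      qed
      moreover have "B \<subseteq> insert a S" using B by (auto simp: invariant_sets_def)
      ultimately show "B - {a} \<in> invariant_sets q S"
        using qS assms(2) by (auto simp: invariant_sets_def)
    qed
    show "(\<lambda>B. if b \<in> B then insert a B else B) ` invariant_sets q S
        \<subseteq> invariant_sets p (insert a S)"
      using assms(2) pa px qS bS by (auto simp: invariant_sets_def split: if_splits)
  qed
  then show ?thesis
    using False by (simp add: bij_betw_same_card p_def)
qed

text \<open>The sign of a permutation is (-1) to the size of the set minus the number of cycles. The
  witness n is the number of cycles, determined by the power of 2, so no notion of cycle is
  needed.\<close>

lemma sign_eq_card_invariant_sets: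
  assumes "finite A" "p permutes A"
  shows "\<exists>n. card (invariant_sets p A) = 2 ^ n \<and> sign p = (-1) ^ (card A + n)"
  using assms
proof (induction A arbitrary: p rule: finite_induct)
  case empty
  then have "sign p = 1" "invariant_sets p {} = {{}}" by (auto simp: invariant_sets_def)
  then show ?case by (intro exI[of _ 0]) simp
next
  case (insert a S)
  define q where "q = transpose a (p a) \<circ> p"
  have q: "q permutes S" unfolding q_def using insert.prems by (rule permutes_insert_lemma)
  have p: "transpose a (p a) \<circ> q = p" by (simp add: q_def fun_eq_iff)
  have pa: "p a \<in> insert a S"
    using permutes_in_image[OF insert.prems, of a] by simp
  obtain n where n: "card (invariant_sets q S) = 2 ^ n" "sign q = (-1) ^ (card S + n)"
    using insert.IH[OF q] by blast
  have "card (invariant_sets p (insert a S)) = (if p a = a then 2 else 1) * 2 ^ n"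
    using card_invariant_sets_insert[OF insert.hyps q pa] n unfolding p by simp
  moreover have "sign p = sign (transpose a (p a)) * sign q"
    using sign_compose[OF permutation_swap_id permutes_imp_permutation[OF insert.hyps(1) q], of a "p a"]
    unfolding p .
  then have "sign p = (if p a = a then 1 else -1) * (-1) ^ (card S + n)"
    using n by (simp add: sign_swap_id)
  ultimately show ?case
    using insert.hyps by (intro exI[of _ "if p a = a then Suc n else n"]) auto
qed

text \<open>Such a B is a union of classes of the equivalence relation generated by r, so it amounts
  to an arbitrary choice of classes.\<close>

lemma card_separated_sets:
  fixes r :: "('a \<times> 'a) set"
  assumes "finite A" "sym r" "r \<subseteq> A \<times> A"
  shows "card {B. B \<subseteq> A \<and> (\<forall>(x, y)\<in>r. y \<in> B \<longleftrightarrow> x \<in> B)} = 2 ^ card (A // r\<^sup>*)" (is "card ?I = _")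
proof -
  have equiv: "equiv UNIV (r\<^sup>*)"
    by (intro equivI) (use assms sym_rtrancl trans_rtrancl in \<open>auto simp: refl_on_def\<close>)
  have closed: "x \<in> A \<longleftrightarrow> y \<in> A" if "(x, y) \<in> r\<^sup>*" for x y
    using that by induction (use assms(3) in auto)
  have inI: "x \<in> B \<longleftrightarrow> y \<in> B" if "(x, y) \<in> r\<^sup>*" "B \<in> ?I" for x y B
    using that(1) by induction (use that(2) in auto)
  have sub: "A // r\<^sup>* \<subseteq> Pow A"
    using closed by (auto simp: quotient_def)
  have fin: "finite (A // r\<^sup>*)"
    using sub assms(1) by (meson finite_Pow_iff finite_subset)
  \<comment> \<open>\<open>B // r\<^sup>*\<close> is the set of classes that meet B, hence lie
    inside B; \<open>Union\<close> undoes it.\<close>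
  have "bij_betw (\<lambda>B. B // r\<^sup>*) ?I (Pow (A // r\<^sup>*))"
  proof (rule bij_betw_byWitness[where f' = Union])
    show "\<forall>B\<in>?I. \<Union> (B // r\<^sup>*) = B"
    proof
      fix B assume B: "B \<in> ?I"
      show "\<Union> (B // r\<^sup>*) = B"
        using inI[OF _ B] by (auto simp: quotient_def)
    qed
    show "\<forall>C\<in>Pow (A // r\<^sup>*). \<Union> C // r\<^sup>* = C"
    proof
      fix C assume "C \<in> Pow (A // r\<^sup>*)"
      then have C: "C \<subseteq> A // r\<^sup>*" by simp
      have cls: "c = r\<^sup>* `` {x}" if c: "c \<in> C" and x: "x \<in> c" for c x
      proof -
        obtain a where "c = r\<^sup>* `` {a}" using C c by (blast elim: quotientE)
        then show ?thesis using x equiv_class_eq[OF equiv, of a x] by auto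
      qed
      show "\<Union> C // r\<^sup>* = C"
      proof (intro set_eqI iffI)
        fix c assume "c \<in> \<Union> C // r\<^sup>*"
        then obtain x d where "x \<in> d" "d \<in> C" "c = r\<^sup>* `` {x}" by (auto simp: quotient_def)
        then show "c \<in> C" using cls by simp
      next
        fix c assume c: "c \<in> C"
        then obtain a where "c = r\<^sup>* `` {a}" using C c by (blast elim: quotientE)
        then have "a \<in> c" by auto
        then show "c \<in> \<Union> C // r\<^sup>*" using c cls by (auto simp: quotient_def)
      qed
    qed
    show "(\<lambda>B. B // r\<^sup>*) ` ?I \<subseteq> Pow (A // r\<^sup>*)"
      by (auto simp: quotient_def)
    show "Union ` Pow (A // r\<^sup>*) \<subseteq> ?I"
    proof clarify
      fix C assume C: "C \<subseteq> A // r\<^sup>*"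
      have "y \<in> \<Union> C \<longleftrightarrow> x \<in> \<Union> C" if "(x, y) \<in> r" for x y
      proof -
        have "y \<in> c \<longleftrightarrow> x \<in> c" if c: "c \<in> C" for c
        proof -
          obtain a where "c = r\<^sup>* `` {a}" using C c by (blast elim: quotientE)
          moreover have "(y, x) \<in> r" using \<open>(x, y) \<in> r\<close> assms(2) by (auto dest: symD)
          ultimately show ?thesis using \<open>(x, y) \<in> r\<close> by (auto intro: rtrancl_into_rtrancl)
        qed
        then show ?thesis by blast
      qed
      moreover have "\<Union> C \<subseteq> A" using C sub by blast
      ultimately show "\<Union> C \<subseteq> A \<and> (\<forall>(x, y)\<in>r. y \<in> \<Union> C \<longleftrightarrow> x \<in> \<Union> C)" by blast
    qed
  qed
  then have "card ?I = card (Pow (A // r\<^sup>*))" by (rule bij_betw_same_card)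
  then show ?thesis using fin by (simp add: card_Pow)
qed

section \<open>The sum over all permutations of a trivial component\<close>

lemma card_invariant_sets_perm_cycles:
  assumes "\<pi> permutes {..<n}"
  shows "card (invariant_sets \<pi> {..<n}) = 2 ^ perm_cycles n \<pi>"
proof -
  let ?r = "{(i, \<pi> i) | i. i < n} \<union> {(\<pi> i, i) | i. i < n}"
  have "\<pi> i < n \<longleftrightarrow> i < n" for i using permutes_in_image[OF assms, of i] by simp
  then have "card {B. B \<subseteq> {..<n} \<and> (\<forall>(x, y)\<in>?r. y \<in> B \<longleftrightarrow> x \<in> B)} = 2 ^ card ({..<n} // ?r\<^sup>*)"
    by (intro card_separated_sets) (auto simp: sym_def)
  moreover have "{B. B \<subseteq> {..<n} \<and> (\<forall>(x, y)\<in>?r. y \<in> B \<longleftrightarrow> x \<in> B)} = invariant_sets \<pi> {..<n}"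
    by (auto simp: invariant_sets_def)
  ultimately show ?thesis by (simp add: perm_cycles_def)
qed

text \<open>This is the generating function of cycle counts, x (x + 1) ... (x + n - 1), at x = 2. A
  new point either forms its own cycle, with factor 2, or enters an existing cycle at one of
  \<open>card S\<close> places, which gives the factor \<open>card S + 2\<close> of the induction
  step.\<close>

lemma sum_card_invariant_sets:
  assumes "finite A"
  shows "(\<Sum>p | p permutes A. card (invariant_sets p A)) = fact (card A + 1)"
  using assms
proof (induction A rule: finite_induct)
  case empty
  have "invariant_sets p {} = {{}}" for p :: "'a \<Rightarrow> 'a"
    by (auto simp: invariant_sets_def)
  then show ?case by simp
next
  case (insert a S)
  let ?c = "\<lambda>p A. card (invariant_sets p A)"
  have "(\<Sum>p | p permutes insert a S. ?c p (insert a S)) =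
      (\<Sum>b\<in>insert a S. \<Sum>q | q permutes S. ?c (transpose a b \<circ> q) (insert a S))"
    using insert.hyps by (rule sum_over_permutations_insert)
  also have "\<dots> = (\<Sum>b\<in>insert a S. \<Sum>q | q permutes S. (if b = a then 2 else 1) * ?c q S)"
    using card_invariant_sets_insert[OF insert.hyps] by (intro sum.cong) auto
  also have "\<dots> = (\<Sum>b\<in>insert a S. (if b = a then 2 else 1) * fact (card S + 1))"
    by (simp only: insert.IH sum_distrib_left[symmetric])
  also have "\<dots> = 2 * fact (card S + 1) + (\<Sum>b\<in>S. (if b = a then 2 else 1) * fact (card S + 1))"
    using insert.hyps by simp
  also have "(\<Sum>b\<in>S. (if b = a then 2 else 1) * fact (card S + 1)) = (\<Sum>b\<in>S. fact (card S + 1) :: nat)"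
    using insert.hyps by (intro sum.cong) auto
  also have "2 * fact (card S + 1) + \<dots> = (fact (card (insert a S) + 1) :: nat)" 
    using insert.hyps by (simp add: algebra_simps)
  finally show ?case .
qed

lemma sum_perms_sign_cycles:
  "(\<Sum>\<pi>\<in>perms_of n. sign \<pi> * (-2) ^ perm_cycles n \<pi>) = (-1) ^ n * fact (n + 1)"
proof -
  have "sign \<pi> * (-2) ^ perm_cycles n \<pi> = (-1) ^ n * int (card (invariant_sets \<pi> {..<n}))"
    if "\<pi> \<in> perms_of n" for \<pi>
  proof -
    have \<pi>: "\<pi> permutes {..<n}" using that by (simp add: perms_of_def)
    obtain k where k: "card (invariant_sets \<pi> {..<n}) = 2 ^ k" "sign \<pi> = (-1) ^ (n + k)"
      using sign_eq_card_invariant_sets[OF _ \<pi>] by auto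
    then have "k = perm_cycles n \<pi>"
      using card_invariant_sets_perm_cycles[OF \<pi>] by simp
    then have "sign \<pi> * (-2) ^ perm_cycles n \<pi> = (-1) ^ n * ((-1) ^ k * (-2) ^ k)"
      using k by (simp add: power_add)
    also have "(-1) ^ k * (-2) ^ k = (2 :: int) ^ k"
      by (simp flip: power_mult_distrib)
    finally show ?thesis using k by simp
  qed
  then have "(\<Sum>\<pi>\<in>perms_of n. sign \<pi> * (-2) ^ perm_cycles n \<pi>)
      = (-1) ^ n * int (\<Sum>\<pi>\<in>perms_of n. card (invariant_sets \<pi> {..<n}))"
    by (simp add: sum_distrib_left)
  also have "(\<Sum>\<pi>\<in>perms_of n. card (invariant_sets \<pi> {..<n})) = fact (n + 1)"
    using sum_card_invariant_sets[of "{..<n}"] by (simp add: perms_of_def)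
  finally show ?thesis by (simp only: of_nat_fact)
qed

section \<open>Alternating sets of a pair of matchings\<close>

definition matching :: "'a set \<Rightarrow> ('a \<Rightarrow> 'a) \<Rightarrow> bool" where
  "matching P E \<longleftrightarrow> (\<forall>x\<in>P. E x \<in> P \<and> E (E x) = x \<and> E x \<noteq> x)"

definition alternating :: "'a set \<Rightarrow> ('a \<Rightarrow> 'a) \<Rightarrow> 'a set \<Rightarrow> bool" where
  "alternating P E S \<longleftrightarrow> S \<subseteq> P \<and> (\<forall>x\<in>P. E x \<in> S \<longleftrightarrow> x \<notin> S)"

lemma matchingD:
  assumes "matching P E" "x \<in> P"
  shows "E x \<in> P" "E (E x) = x" "E x \<noteq> x"
  using assms by (auto simp: matching_def)

lemma alternatingD:
  assumes "alternating P E S"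
  shows "S \<subseteq> P" "x \<in> P \<Longrightarrow> E x \<in> S \<longleftrightarrow> x \<notin> S"
  using assms by (auto simp: alternating_def)

text \<open>The union of two perfect matchings consists of even closed curves, and these can be
  2-coloured. The induction removes one arc of V and shortcuts E across it.\<close>

lemma ex_alternating:
  assumes "finite P" "matching P V" "matching P E"
  shows "\<exists>S. alternating P V S \<and> alternating P E S"
  using assms
proof (induction "card P" arbitrary: P E rule: less_induct)
  case less
  note V = matchingD[OF less.prems(2)] and E = matchingD[OF less.prems(3)]
  show ?case
  proof (cases "P = {}")
    case True
    then show ?thesis by (auto simp: alternating_def)
  next
    case False
    then obtain x where x: "x \<in> P" by blast
    define y where "y = V x"
    define u where "u = E x"
    define w where "w = E y"
    define Q where "Q = P - {x, y}"
    have xy: "y \<in> P" "y \<noteq> x" "V y = x" using V[OF x] by (auto simp: y_def)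
    have u: "u \<in> P" "u \<noteq> x" "E u = x" using E[OF x] by (auto simp: u_def)
    have w: "w \<in> P" "w \<noteq> y" "E w = y" using E[OF xy(1)] by (auto simp: w_def)
    have Q: "card Q < card P" "finite Q"
      using x less.prems(1) by (auto simp: Q_def intro: psubset_card_mono)
    have VQ: "matching Q V"
      unfolding matching_def
    proof
      fix z assume "z \<in> Q"
      then have z: "z \<in> P" "z \<noteq> x" "z \<noteq> y" by (auto simp: Q_def)
      then have "V z \<noteq> x" "V z \<noteq> y" using V(2)[of z] xy(3) y_def by auto
      then show "V z \<in> Q \<and> V (V z) = z \<and> V z \<noteq> z" using V[of z] z by (auto simp: Q_def)
    qed
    \<comment> \<open>The path from u through x and y to w is contracted to a single arc from u to
      w. If u = y then w = x and the changed values lie outside Q.\<close>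
    define F where "F = (\<lambda>z. if z = u then w else if z = w then u else E z)"
    have FQ: "matching Q F"
      unfolding matching_def
    proof
      fix z assume "z \<in> Q"
      then have z: "z \<in> P" "z \<noteq> x" "z \<noteq> y" by (auto simp: Q_def)
      have Ez: "E z \<in> P" "E (E z) = z" "E z \<noteq> z" using E[OF z(1)] by auto
      have Exy: "E z = x \<longleftrightarrow> z = u" "E z = y \<longleftrightarrow> z = w"
        using Ez u w u_def w_def by metis+
      have uw: "u = y \<longleftrightarrow> w = x" "u \<noteq> w" using u w xy u_def w_def by metis+
      have Euw: "E z \<noteq> u" "E z \<noteq> w" using Ez u w z by metis+
      show "F z \<in> Q \<and> F (F z) = z \<and> F z \<noteq> z"
        using z Ez Exy uw Euw u w by (auto simp: F_def Q_def)
    qed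
    obtain S where S: "alternating Q V S" "alternating Q F S"
      using less.hyps[OF Q(1) Q(2) VQ FQ] by blast
    note VS = alternatingD[OF S(1)] and FS = alternatingD[OF S(2)]
    \<comment> \<open>The end x must lie on the side opposite to its partner u. When u = y the curve
      consists of x and y alone, u is not in S, and choosing x is arbitrary.\<close>
    define T where "T = (if u \<in> S then insert y S else insert x S)"
    have PQ: "z \<in> P \<longleftrightarrow> z = x \<or> z = y \<or> z \<in> Q" for z
      using x xy by (auto simp: Q_def)
    have "alternating P V T"
      unfolding alternating_def
    proof (intro conjI ballI)
      show "T \<subseteq> P" using VS(1) x xy by (auto simp: T_def Q_def)
      fix z assume "z \<in> P"
      then consider "z = x" | "z = y" | "z \<in> Q" using PQ by blast
      then show "V z \<in> T \<longleftrightarrow> z \<notin> T"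
      proof cases
        case 1
        then show ?thesis using VS(1) xy by (auto simp: T_def Q_def simp flip: y_def)
      next
        case 2
        then show ?thesis using VS(1) xy by (auto simp: T_def Q_def)
      next
        case 3
        moreover have "V z \<in> Q" using matchingD(1)[OF VQ 3] .
        ultimately show ?thesis using VS(2)[OF 3] by (auto simp: T_def Q_def)
      qed
    qed
    moreover have "alternating P E T"
      unfolding alternating_def
    proof (intro conjI ballI)
      show "T \<subseteq> P" using VS(1) x xy by (auto simp: T_def Q_def)
      fix z assume z: "z \<in> P"
      show "E z \<in> T \<longleftrightarrow> z \<notin> T"
      proof (cases "u = y")
        case True
        then have wx: "w = x" using u w_def by simp
        have uS: "u \<notin> S" "x \<notin> S" using True VS(1) by (auto simp: Q_def)
        consider "z = x" | "z = y" | "z \<in> Q" using PQ z by blast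
        then show ?thesis
        proof cases
          case 1
          then show ?thesis using uS True u by (auto simp: T_def simp flip: u_def)
        next
          case 2
          then show ?thesis using uS True u xy wx by (auto simp: T_def simp flip: w_def)
        next
          case 3
          then have "F z = E z" using True wx by (auto simp: F_def Q_def)
          moreover have "F z \<in> Q" using matchingD(1)[OF FQ 3] .
          ultimately show ?thesis using FS(2)[OF 3] 3 uS by (auto simp: T_def Q_def)
        qed
      next
        case False
        then have wx: "w \<noteq> x" "u \<noteq> w" using u w E xy by metis+
        have uQ: "u \<in> Q" "w \<in> Q" using False wx u w by (auto simp: Q_def)
        have uw: "w \<in> S \<longleftrightarrow> u \<notin> S" using FS(2)[OF uQ(1)] by (simp add: F_def)
        have xyS: "x \<notin> S" "y \<notin> S" using VS(1) by (auto simp: Q_def)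
        consider "z = x" | "z = y" | "z = u" | "z = w" | "z \<in> Q" "z \<noteq> u" "z \<noteq> w"
          using PQ z by blast
        then show ?thesis
        proof cases
          case 1
          then show ?thesis using uw xyS xy u False by (auto simp: T_def simp flip: u_def)
        next
          case 2
          then show ?thesis using uw xyS xy w wx by (auto simp: T_def simp flip: w_def)
        next
          case 3
          then show ?thesis using uw xyS xy u False by (auto simp: T_def)
        next
          case 4
          then show ?thesis using uw xyS xy w wx by (auto simp: T_def)
        next
          case 5
          then have "F z = E z" by (auto simp: F_def)
          moreover have "F z \<in> Q" using matchingD(1)[OF FQ 5(1)] .
          ultimately show ?thesis using FS(2)[OF 5(1)] 5 by (auto simp: T_def Q_def)
        qed
      qed
    qed
    ultimately show ?thesis by blast
  qed
qed

section \<open>Counting and traversing the curves of two matchings\<close>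

definition matching_curves :: "'a set \<Rightarrow> ('a \<Rightarrow> 'a) \<Rightarrow> ('a \<Rightarrow> 'a) \<Rightarrow> nat" where
  "matching_curves P V E = card (P // ({(x, V x) | x. x \<in> P} \<union> {(x, E x) | x. x \<in> P})\<^sup>*)"

lemma card_invariant_sets_matchings:
  assumes "finite P" "matching P V" "matching P E"
  shows "card (invariant_sets V P \<inter> invariant_sets E P) = 2 ^ matching_curves P V E"
proof -
  note V = matchingD[OF assms(2)] and E = matchingD[OF assms(3)]
  let ?r = "{(x, V x) | x. x \<in> P} \<union> {(x, E x) | x. x \<in> P}"
  have "sym ?r"
    by (rule symI) (use V E in force)
  then have "card {B. B \<subseteq> P \<and> (\<forall>(x, y)\<in>?r. y \<in> B \<longleftrightarrow> x \<in> B)} = 2 ^ card (P // ?r\<^sup>*)"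
    using V E by (intro card_separated_sets assms(1)) auto
  moreover have "{B. B \<subseteq> P \<and> (\<forall>(x, y)\<in>?r. y \<in> B \<longleftrightarrow> x \<in> B)} =
      invariant_sets V P \<inter> invariant_sets E P"
    by (auto simp: invariant_sets_def)
  ultimately show ?thesis by (simp add: matching_curves_def)
qed

text \<open>Symmetric difference with one fixed alternating set exchanges alternating sets with
  unions of curves: it records on which curves the two directions differ.\<close>

lemma card_alternating:
  assumes "finite P" "matching P V" "matching P E"
  shows "card {S. alternating P V S \<and> alternating P E S} = 2 ^ matching_curves P V E"
proof -
  obtain S0 where S0: "alternating P V S0" "alternating P E S0"
    using ex_alternating[OF assms] by blast
  note VS0 = alternatingD[OF S0(1)] and ES0 = alternatingD[OF S0(2)]
  let ?d = "\<lambda>B. (S0 - B) \<union> (B - S0)"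
  have "bij_betw ?d {S. alternating P V S \<and> alternating P E S}
      (invariant_sets V P \<inter> invariant_sets E P)"
  proof (rule bij_betw_byWitness[where f' = ?d])
    show "?d ` {S. alternating P V S \<and> alternating P E S} \<subseteq> invariant_sets V P \<inter> invariant_sets E P"
      using VS0 ES0 unfolding invariant_sets_def alternating_def by (auto; blast)
    show "?d ` (invariant_sets V P \<inter> invariant_sets E P) \<subseteq> {S. alternating P V S \<and> alternating P E S}"
      using VS0 ES0 unfolding invariant_sets_def alternating_def by (auto; blast)
  qed auto
  then show ?thesis
    using card_invariant_sets_matchings[OF assms] by (simp add: bij_betw_same_card)
qed

text \<open>An end in S is left along V and lands outside S, an end outside S is left along E and
  lands in S. Both kinds of arcs are thus used in turn, and each curve becomes one cycle through all
  its ends.\<close>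

definition traverse :: "('a \<Rightarrow> 'a) \<Rightarrow> ('a \<Rightarrow> 'a) \<Rightarrow> 'a set \<Rightarrow> 'a \<Rightarrow> 'a" where
  "traverse V E S x = (if x \<in> S then V x else E x)"

lemma bij_betw_traverse:
  assumes "matching P V" "matching P E" "alternating P V S" "alternating P E S"
  shows "bij_betw (traverse V E S) P P"
  \<comment> \<open>Exchanging the two matchings walks the curves backwards.\<close>
  by (rule bij_betw_byWitness[where f' = "traverse E V S"])
    (use assms in \<open>auto simp: traverse_def matching_def alternating_def\<close>)

lemma sign_traverse:
  assumes "finite P" "matching P V" "matching P E" "alternating P V S" "alternating P E S"
  shows "sign_on P (traverse V E S) = (-1) ^ (card P + matching_curves P V E)"
proof -
  note V = matchingD[OF assms(2)] and E = matchingD[OF assms(3)]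
  note VS = alternatingD[OF assms(4)] and ES = alternatingD[OF assms(5)]
  let ?R = "restrict_id (traverse V E S) P"
  have R: "?R permutes P"
    using bij_betw_traverse[OF assms(2-5)] by (rule permutes_restrict_id)
  have "invariant_sets ?R P = invariant_sets V P \<inter> invariant_sets E P"
  proof (intro set_eqI iffI)
    fix B assume "B \<in> invariant_sets ?R P"
    then have B: "B \<subseteq> P" "\<And>x. x \<in> P \<Longrightarrow> traverse V E S x \<in> B \<longleftrightarrow> x \<in> B"
      by (auto simp: invariant_sets_def)
    have "V x \<in> B \<longleftrightarrow> x \<in> B" if "x \<in> P" for x
    proof (cases "x \<in> S")
      case True
      then show ?thesis using B(2)[OF that] by (simp add: traverse_def)
    next
      case False
      \<comment> \<open>Here the traversal does not leave x along V, but it leaves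
        \<open>V x\<close> along V and arrives at x.\<close>
      then have "V x \<in> S" using VS(2) that by simp
      then show ?thesis using B(2)[of "V x"] V[OF that] by (simp add: traverse_def)
    qed
    moreover have "E x \<in> B \<longleftrightarrow> x \<in> B" if "x \<in> P" for x
    proof (cases "x \<in> S")
      case False
      then show ?thesis using B(2)[OF that] by (simp add: traverse_def)
    next
      case True
      then have "E x \<notin> S" using ES(2) that by simp
      then show ?thesis using B(2)[of "E x"] E[OF that] by (simp add: traverse_def)
    qed
    ultimately show "B \<in> invariant_sets V P \<inter> invariant_sets E P"
      using B(1) by (auto simp: invariant_sets_def)
  next
    fix B assume "B \<in> invariant_sets V P \<inter> invariant_sets E P"
    then show "B \<in> invariant_sets ?R P"
      by (auto simp: invariant_sets_def traverse_def)
  qed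
  then show ?thesis
    using sign_eq_card_invariant_sets[OF assms(1) R] card_invariant_sets_matchings[OF assms(1-3)]
    by (auto simp: sign_on_def)
qed

section \<open>The sign of a configuration\<close>

text \<open>Only this much of a spin network matters for the sign. X holds the ends on outgoing
  half-edges, so an arc of V with both ends in X or both outside X is one where the orientation
  turns. G selects exactly one end of each turning arc; this is the part of the gate signage that
  the sign depends on. E0 is a reference against which the edge permutations are measured.\<close>

locale oriented_matching =
  fixes P X G :: "'a set" and V E0 :: "'a \<Rightarrow> 'a"
  assumes finite_P: "finite P"
    and V: "matching P V"
    and E0: "matching P E0" "alternating P E0 X"
    and G_sub: "G \<subseteq> P"
    and G_choice: "\<And>x. x \<in> P \<Longrightarrow> (V x \<in> X \<longleftrightarrow> x \<in> X) \<Longrightarrow> V x \<in> G \<longleftrightarrow> x \<notin> G"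
    and G_turn: "\<And>x. x \<in> G \<Longrightarrow> V x \<in> X \<longleftrightarrow> x \<in> X"
begin

definition configuration :: "('a \<Rightarrow> 'a) \<Rightarrow> 'a set \<Rightarrow> bool" where
  "configuration E S \<longleftrightarrow>
     matching P E \<and> alternating P E X \<and> alternating P E S \<and> alternating P V S"

definition turn_sign :: "'a set \<Rightarrow> int" where
  "turn_sign S = (\<Prod>x\<in>G. if (x \<in> S) = (x \<in> X) then 1 else -1)"

text \<open>E carries X to its complement and E0 brings it back, so \<open>E0 \<circ> E\<close>
  permutes X. In a spin network its sign is the product of the signs of the edge
  permutations.\<close>

definition total_sign :: "('a \<Rightarrow> 'a) \<Rightarrow> 'a set \<Rightarrow> int" where
  "total_sign E S = sign_on P (traverse V E S) * sign_on X (E0 \<circ> E) * turn_sign S"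

lemma X_sub: "X \<subseteq> P"
  using E0(2) by (rule alternatingD)

lemma finite_X: "finite X"
  using finite_P X_sub by (rule rev_finite_subset)

lemma bij_betw_matching:
  assumes "matching P E" "A \<subseteq> P" "B \<subseteq> P" "\<And>x. x \<in> A \<Longrightarrow> E x \<in> B" "\<And>x. x \<in> B \<Longrightarrow> E x \<in> A"
  shows "bij_betw E A B"
  by (rule bij_betw_byWitness[where f' = E]) (use assms in \<open>auto simp: matching_def\<close>)

lemma bij_betw_half:
  assumes "matching P E" "alternating P E X"
  shows "bij_betw E X (P - X)" "bij_betw E (P - X) X"
  by (rule bij_betw_matching[OF assms(1)]; use assms X_sub in \<open>auto simp: alternating_def matching_def\<close>)+

lemma bij_betw_half_comp:
  assumes "matching P E" "alternating P E X" "matching P F" "alternating P F X"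
  shows "bij_betw (F \<circ> E) X X"
  using bij_betw_half[OF assms(1,2)] bij_betw_half[OF assms(3,4)] by (blast intro: bij_betw_trans)

text \<open>Replacing E by F multiplies the traversal by \<open>F \<circ> E\<close> restricted to S,
  and the permutation of X by \<open>E \<circ> F\<close>. Cut along X and S respectively, these
  share the piece \<open>S \<inter> X\<close> up to inversion, and their other pieces
  \<open>S - X\<close> and \<open>X - S\<close> are conjugate, so both signs change by the same
  factor \<open>?m\<close>.\<close>

lemma total_sign_same_set:
  assumes "configuration E S" "configuration F S"
  shows "total_sign F S = total_sign E S"
proof -
  note E = assms(1)[unfolded configuration_def] and F = assms(2)[unfolded configuration_def]
  have S: "S \<subseteq> P" using E by (auto simp: alternating_def)
  then have fin: "finite S" using finite_P by (rule finite_subset)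
  have PE: "E z \<in> P" "E (E z) = z" and PF: "F z \<in> P" "F (F z) = z" if "z \<in> P" for z
    using E F that by (auto simp: matching_def)
  have EX: "E x \<in> X \<longleftrightarrow> x \<notin> X" "F x \<in> X \<longleftrightarrow> x \<notin> X" "E x \<in> S \<longleftrightarrow> x \<notin> S" "F x \<in> S \<longleftrightarrow> x \<notin> S"
    "V x \<in> S \<longleftrightarrow> x \<notin> S"
    if "x \<in> P" for x using E F that by (auto simp: alternating_def)
  have bij: "bij_betw (F \<circ> E) A A" and bij': "bij_betw (E \<circ> F) A A"
    if "A \<in> {S, X, S \<inter> X, S - X, X - S}" for A
  proof -
    have A: "A \<subseteq> P" using that S X_sub by auto
    have FE: "F (E x) \<in> A \<longleftrightarrow> x \<in> A" "E (F x) \<in> A \<longleftrightarrow> x \<in> A"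
      "E (F (F (E x))) = x" "F (E (E (F x))) = x" if "x \<in> P" for x
      using \<open>A \<in> _\<close> EX[OF that] EX[of "E x"] EX[of "F x"] PE[OF that] PF[OF that]
        PE[of "F x"] PF[of "E x"] by auto
    show "bij_betw (F \<circ> E) A A"
      by (rule bij_betw_byWitness[where f' = "E \<circ> F"]) (use A FE in auto)
    show "bij_betw (E \<circ> F) A A"
      by (rule bij_betw_byWitness[where f' = "F \<circ> E"]) (use A FE in auto)
  qed
  let ?m = "sign_on (S \<inter> X) (F \<circ> E) * sign_on (S - X) (F \<circ> E)"
  let ?M = "restrict_id (F \<circ> E) S"
  have M: "bij_betw ?M P P"
    using bij[of S] S by (intro bij_betw_restrict_id) auto
  \<comment> \<open>Off S, a step along F is a step along E into S followed by
    \<open>F \<circ> E\<close>; on S, the step along V leaves S, where \<open>?M\<close> is the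
    identity.\<close>
  have "sign_on P (traverse V F S) = sign_on P (?M \<circ> traverse V E S)"
    using E F EX PE PF by (intro sign_on_cong) (auto simp: traverse_def restrict_id_def)
  also have "\<dots> = sign_on P ?M * sign_on P (traverse V E S)"
    using E V by (intro sign_on_compose M finite_P bij_betw_traverse) auto
  also have "sign_on P ?M = sign_on S (F \<circ> E)"
    using sign_on_permutes[OF permutes_restrict_id[OF bij] S] by (simp add: sign_on_def)
  also have "S = S \<inter> X \<union> (S - X)" by blast
  also have "sign_on (S \<inter> X \<union> (S - X)) (F \<circ> E) = ?m"
    using fin bij by (intro sign_on_Un) auto
  finally have 1: "sign_on P (traverse V F S) = ?m * sign_on P (traverse V E S)"
    by (simp only: Un_commute Int_Diff_Un Un_Diff_Int)
  have "sign_on X (E0 \<circ> F) = sign_on X ((E0 \<circ> E) \<circ> (E \<circ> F))"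
    using E F PE PF X_sub by (intro sign_on_cong) auto
  also have "\<dots> = sign_on X (E0 \<circ> E) * sign_on X (E \<circ> F)"
    using E bij'[of X] by (intro sign_on_compose bij_betw_half_comp[OF _ _ E0] finite_X) auto
  also have "sign_on X (E \<circ> F) = sign_on (S \<inter> X \<union> (X - S)) (E \<circ> F)"
    by (rule arg_cong[where f = "\<lambda>A. sign_on A (E \<circ> F)"]) blast
  also have "\<dots> = sign_on (S \<inter> X) (E \<circ> F) * sign_on (X - S) (E \<circ> F)"
    using finite_X fin bij' by (intro sign_on_Un) auto
  also have "sign_on (S \<inter> X) (E \<circ> F) = sign_on (S \<inter> X) (F \<circ> E)"
  proof (rule sign_on_inverse[OF _ bij])
    show "(E \<circ> F) x \<in> S \<inter> X \<and> (F \<circ> E) ((E \<circ> F) x) = x" if "x \<in> S \<inter> X" for x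
      using that bij_betwE[OF bij'[of "S \<inter> X"]] S PE[of "F x"] PF[of x] by auto
  qed (use fin in auto)
  \<comment> \<open>F itself carries \<open>X - S\<close> to \<open>S - X\<close> and intertwines
    the two compositions.\<close>
  also have "sign_on (X - S) (E \<circ> F) = sign_on (S - X) (F \<circ> E)"
  proof (rule sign_on_conjugate[symmetric])
    show "bij_betw F (X - S) (S - X)"
      using F X_sub S EX(2,4) PF(1) by (intro bij_betw_matching) auto
  qed (use finite_X bij' in auto)
  finally have 2: "sign_on X (E0 \<circ> F) = sign_on X (E0 \<circ> E) * ?m" .
  have "(a * b) * (a * b) = 1" if "a * a = 1" "b * b = 1" for a b :: int
    using that by algebra
  then have "?m * ?m = 1" by (simp add: sign_on_def)
  moreover have "m * p * (r * m) * t = p * r * t" if "m * m = 1" for m p r t :: int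
    using that by algebra
  ultimately have "?m * sign_on P (traverse V E S) * (sign_on X (E0 \<circ> E) * ?m) * turn_sign S =
      sign_on P (traverse V E S) * sign_on X (E0 \<circ> E) * turn_sign S"
    by blast
  then show ?thesis unfolding total_sign_def 1 2 .
qed

section \<open>Reversing a single vertex arc\<close>

text \<open>On X only one side of a modification of E is visible: a transposition inside X acts
  before E, one outside X acts after E and is carried into X by E0. The hypothesis on F covers both
  moves below.\<close>

lemma sign_on_half_transpose:
  assumes "matching P E" "alternating P E X"
    and ab: "a \<in> P" "b \<in> P" "a \<noteq> b" "a \<in> X \<longleftrightarrow> b \<in> X"
    and F: "\<And>z. z \<in> X \<Longrightarrow> F z = (if a \<in> X then E (transpose a b z) else transpose a b (E z))"
  shows "sign_on X (E0 \<circ> F) = - sign_on X (E0 \<circ> E)"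
proof (cases "a \<in> X")
  case True
  have "sign_on X (E0 \<circ> F) = sign_on X ((E0 \<circ> E) \<circ> transpose a b)"
    using F True by (intro sign_on_cong) auto
  also have "\<dots> = sign_on X (E0 \<circ> E) * sign_on X (transpose a b)"
    using True ab assms(1,2) E0 permutes_imp_bij[OF permutes_swap_id]
    by (intro sign_on_compose bij_betw_half_comp finite_X) auto
  finally show ?thesis using True ab by (simp add: sign_on_transpose)
next
  case False
  have E0P: "E0 (E0 z) = z" if "z \<in> P" for z using matchingD[OF E0(1) that] by simp
  have t: "bij_betw (transpose a b) (P - X) (P - X)"
    using False ab by (intro permutes_imp_bij permutes_swap_id) auto
  have "bij_betw (E0 \<circ> (transpose a b \<circ> E0)) X X"
    using bij_betw_half[OF E0] t by (blast intro: bij_betw_trans)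
  moreover have "sign_on X (E0 \<circ> F) = sign_on X ((E0 \<circ> (transpose a b \<circ> E0)) \<circ> (E0 \<circ> E))"
    using F False E0P X_sub matchingD(1)[OF assms(1)] by (intro sign_on_cong) auto
  ultimately have "sign_on X (E0 \<circ> F) =
      sign_on X (E0 \<circ> (transpose a b \<circ> E0)) * sign_on X (E0 \<circ> E)"
    using sign_on_compose[OF _ bij_betw_half_comp[OF assms(1,2) E0] finite_X] by (simp only:)
  also have "sign_on X (E0 \<circ> (transpose a b \<circ> E0)) = sign_on (P - X) (transpose a b)"
    using E0P finite_P by (intro sign_on_conjugate[OF _ bij_betw_half(2)[OF E0] t]) auto
  finally show ?thesis using False ab by (simp add: sign_on_transpose)
qed

lemma turn_sign_cong:
  assumes "\<And>z. z \<in> G \<Longrightarrow> z \<in> S \<longleftrightarrow> z \<in> T"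
  shows "turn_sign S = turn_sign T"
  using assms by (simp add: turn_sign_def)

text \<open>The transposition of x and \<open>V x\<close> commutes with V and preserves X, so
  everything can be conjugated by it. The traversal keeps its sign, the edge part loses one, and so
  does the turning sign, because exactly one of the two ends lies in G.\<close>

lemma flip_turn:
  assumes E: "configuration E S" and x: "x \<in> S" and turn: "V x \<in> X \<longleftrightarrow> x \<in> X"
  shows "\<exists>F. configuration F (insert (V x) (S - {x})) \<and>
    total_sign F (insert (V x) (S - {x})) = total_sign E S"
proof -
  define y where "y = V x"
  define t where "t = transpose x y"
  define T where "T = insert y (S - {x})"
  define F where "F = t \<circ> E \<circ> t"
  note Ec = E[unfolded configuration_def]
  have S: "S \<subseteq> P" using Ec by (auto simp: alternating_def)
  have PE: "E z \<in> P" "E (E z) = z" "E z \<noteq> z" if "z \<in> P" for z using Ec that by (auto simp: matching_def)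
  have PV: "V z \<in> P" "V (V z) = z" "V z \<noteq> z" if "z \<in> P" for z using V that by (auto simp: matching_def)
  have EX: "E z \<in> X \<longleftrightarrow> z \<notin> X" "E z \<in> S \<longleftrightarrow> z \<notin> S" "V z \<in> S \<longleftrightarrow> z \<notin> S" if "z \<in> P" for z
    using Ec that by (auto simp: alternating_def)
  have xy: "x \<in> P" "y \<in> P" "y \<noteq> x" "V y = x" "y \<notin> S" "y \<in> X \<longleftrightarrow> x \<in> X"
    using x S PV EX turn by (auto simp: y_def)
  have tt: "t (t z) = z" for z by (simp add: t_def)
  have tP: "t z \<in> P \<longleftrightarrow> z \<in> P" and tX: "t z \<in> X \<longleftrightarrow> z \<in> X" for z
    using xy by (auto simp: t_def transpose_def)
  have tS: "t z \<in> T \<longleftrightarrow> z \<in> S" "t z \<in> S \<longleftrightarrow> z \<in> T" for z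
    using xy x by (auto simp: t_def transpose_def T_def)
  have tV: "V (t z) = t (V z)" if "z \<in> P" for z
    using xy PV[OF that] y_def by (auto simp: t_def transpose_def)
  have "matching P F"
    unfolding matching_def
  proof
    fix z assume "z \<in> P"
    then have Etz: "E (t z) \<in> P" "E (E (t z)) = t z" "E (t z) \<noteq> t z" using PE tP by auto
    then have "t (E (t z)) \<noteq> z" by (metis tt)
    then show "F z \<in> P \<and> F (F z) = z \<and> F z \<noteq> z"
      using Etz by (simp add: F_def tP tt)
  qed
  moreover have "alternating P F X"
    unfolding alternating_def F_def using EX tX tP X_sub by auto
  moreover have "T \<subseteq> P" using S xy by (auto simp: T_def)
  then have "alternating P F T"
    unfolding alternating_def using EX(2) tP tS by (simp add: F_def)
  moreover have "alternating P V T"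
    unfolding alternating_def
  proof (intro conjI ballI)
    fix z assume z: "z \<in> P"
    show "V z \<in> T \<longleftrightarrow> z \<notin> T"
      using z EX(3)[of "t z"] tP tS(2) tV[OF z] by simp
  qed fact
  ultimately have "configuration F T" by (simp add: configuration_def)
  moreover have "total_sign F T = total_sign E S"
  proof -
    have "sign_on P (traverse V F T) = sign_on P (traverse V E S)"
    proof (rule sign_on_conjugate)
      show "bij_betw t P P" using xy by (simp add: t_def permutes_imp_bij permutes_swap_id)
      show "bij_betw (traverse V E S) P P" using Ec V by (intro bij_betw_traverse) auto
      show "traverse V F T (t z) = t (traverse V E S z)" if "z \<in> P" for z
        using that tS tV tt by (simp add: traverse_def F_def)
    qed (rule finite_P)
    moreover have "sign_on X (E0 \<circ> F) = - sign_on X (E0 \<circ> E)"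
    proof (rule sign_on_half_transpose[of _ x y])
      fix z assume z: "z \<in> X"
      have "transpose x y w = w" if "w \<in> X \<longleftrightarrow> x \<notin> X" for w
        using that xy by (auto simp: transpose_def)
      then show "F z = (if x \<in> X then E (transpose x y z) else transpose x y (E z))"
        using z EX(1)[of z] EX(1)[of "t z"] tX tP X_sub by (auto simp: F_def t_def)
    qed (use Ec xy in auto)
    moreover have "turn_sign T = - turn_sign S"
    proof -
      obtain g where g: "g \<in> G" "g \<in> {x, y}" "G \<inter> {x, y} = {g}"
        using G_choice[OF xy(1) turn] xy(3) unfolding y_def by blast
      have rest: "(\<Prod>z\<in>G - {g}. if (z \<in> T) = (z \<in> X) then 1 else -1 :: int) =
          (\<Prod>z\<in>G - {g}. if (z \<in> S) = (z \<in> X) then 1 else -1)"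
        using g(3) by (intro prod.cong) (auto simp: T_def)
      have "g \<in> T \<longleftrightarrow> g \<notin> S" using g(2) xy x by (auto simp: T_def)
      then have "(if (g \<in> T) = (g \<in> X) then 1 else -1 :: int) = - (if (g \<in> S) = (g \<in> X) then 1 else -1)"
        by auto
      then show ?thesis
        using rest g(1) finite_subset[OF G_sub finite_P]
        by (simp only: turn_sign_def prod.remove)
    qed
    ultimately show ?thesis by (simp add: total_sign_def)
  qed
  ultimately show ?thesis unfolding T_def y_def by blast
qed

text \<open>The ends x and y = \<open>V x\<close> lie on different sides of X, so E may join them
  directly. Its old partners u and w are then joined to each other, which splits off x and y as a
  curve of their own. The traversal and the edge part each change by a transposition, and the
  turning sign is untouched because the arc does not meet G.\<close>

lemma flip_through:
  assumes E: "configuration E S" and x: "x \<in> S" and through: "V x \<in> X \<longleftrightarrow> x \<notin> X"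
  shows "\<exists>F. configuration F (insert (V x) (S - {x})) \<and>
    total_sign F (insert (V x) (S - {x})) = total_sign E S"
proof -
  define y where "y = V x"
  define T where "T = insert y (S - {x})"
  note Ec = E[unfolded configuration_def]
  have S: "S \<subseteq> P" using Ec by (auto simp: alternating_def)
  have PE: "E z \<in> P" "E (E z) = z" "E z \<noteq> z" if "z \<in> P" for z using Ec that by (auto simp: matching_def)
  have PV: "V z \<in> P" "V (V z) = z" "V z \<noteq> z" if "z \<in> P" for z using V that by (auto simp: matching_def)
  have EX: "E z \<in> X \<longleftrightarrow> z \<notin> X" "E z \<in> S \<longleftrightarrow> z \<notin> S" "V z \<in> S \<longleftrightarrow> z \<notin> S" if "z \<in> P" for z
    using Ec that by (auto simp: alternating_def)
  have xy: "x \<in> P" "y \<in> P" "y \<noteq> x" "V y = x" "y \<notin> S" "y \<in> X \<longleftrightarrow> x \<notin> X"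
    using x S PV EX through by (auto simp: y_def)
  have VT: "alternating P V T"
    unfolding alternating_def
  proof (intro conjI ballI)
    show "T \<subseteq> P" using S xy by (auto simp: T_def)
    fix z assume z: "z \<in> P"
    have "V z = x \<longleftrightarrow> z = y" "V z = y \<longleftrightarrow> z = x" using PV(2)[OF z] xy(4) y_def by metis+
    then show "V z \<in> T \<longleftrightarrow> z \<notin> T" using EX(3)[OF z] xy x by (auto simp: T_def)
  qed
  have "x \<notin> G" "y \<notin> G" using G_turn[of x] G_turn[of y] xy through by (auto simp: y_def)
  then have turn: "turn_sign T = turn_sign S"
    by (intro turn_sign_cong) (auto simp: T_def)
  define u where "u = E x"
  define w where "w = E y"
  have u: "u \<in> P" "u \<noteq> x" "E u = x" "u \<notin> S" "u \<in> X \<longleftrightarrow> x \<notin> X"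
    using PE[OF xy(1)] EX[OF xy(1)] x by (auto simp: u_def)
  have w: "w \<in> P" "w \<noteq> y" "E w = y" "w \<in> S" "w \<in> X \<longleftrightarrow> x \<in> X"
    using PE[OF xy(2)] EX[OF xy(2)] xy by (auto simp: w_def)
  have Ez: "E z = x \<longleftrightarrow> z = u" "E z = y \<longleftrightarrow> z = w" "E z = u \<longleftrightarrow> z = x" "E z = w \<longleftrightarrow> z = y"
    if "z \<in> P" for z
    using PE(2)[OF that] u(3) w(3) u_def w_def by metis+
  have Vz: "V z = x \<longleftrightarrow> z = y" if "z \<in> P" for z using PV(2)[OF that] xy(4) y_def by metis
  have "\<exists>F. configuration F T \<and> total_sign F T = total_sign E S"
  \<comment> \<open>In this case x and y already form a whole curve, and going round two points is
    the same in both directions.\<close>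
  proof (cases "u = y")
    case True
    then have wx: "w = x" using u w_def by simp
    have "alternating P E T"
      unfolding alternating_def
    proof (intro conjI ballI)
      show "T \<subseteq> P" using S xy by (auto simp: T_def)
      fix z assume z: "z \<in> P"
      show "E z \<in> T \<longleftrightarrow> z \<notin> T" using EX(2)[OF z] Ez[OF z] True wx xy x by (auto simp: T_def)
    qed
    then have "configuration E T" using Ec VT by (simp add: configuration_def)
    moreover have "sign_on P (traverse V E T) = sign_on P (traverse V E S)"
      using True wx xy x u w u_def w_def y_def
      by (intro sign_on_cong) (auto simp: T_def traverse_def)
    ultimately show ?thesis using turn by (auto simp: total_sign_def)
  next
    case False
    have wx: "w \<noteq> x" using w False u_def by auto
    have uw: "u \<noteq> w" using u w by auto
    define F where
      "F = (\<lambda>z. if z = x then y else if z = y then x else if z = u then w else if z = w then u else E z)"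
    have "matching P F"
      unfolding matching_def F_def using PE Ez xy u w uw wx False by auto
    moreover have "alternating P F X"
      unfolding alternating_def F_def using EX Ez X_sub xy u w uw wx False by auto
    moreover have "alternating P F T"
      unfolding alternating_def F_def T_def using EX Ez S xy x u w uw wx False by auto
    ultimately have "configuration F T" using VT by (simp add: configuration_def)
    moreover have "sign_on P (traverse V F T) = - sign_on P (traverse V E S)"
    proof -
      \<comment> \<open>In the old traversal u leads to x and y leads to w; in the new one u leads
        to w and y to x. All other steps agree.\<close>
      have t: "bij_betw (transpose x w) P P"
        using xy w by (intro permutes_imp_bij permutes_swap_id) auto
      have "traverse V F T z = transpose x w (traverse V E S z)" if z: "z \<in> P" for z
      proof -
        have "V z \<noteq> w" if "z \<in> S" using EX(3)[OF z] that w by auto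
        then show ?thesis
          using xy x u w uw wx False Ez[OF z] Vz[OF z] u_def w_def y_def
          by (auto simp: traverse_def F_def T_def transpose_def)
      qed
      then have "sign_on P (traverse V F T) = sign_on P (transpose x w \<circ> traverse V E S)"
        by (intro sign_on_cong) auto
      also have "\<dots> = sign_on P (transpose x w) * sign_on P (traverse V E S)"
        using Ec V t by (intro sign_on_compose bij_betw_traverse finite_P) auto
      finally show ?thesis using xy w wx by (simp add: sign_on_transpose)
    qed
    moreover have "sign_on X (E0 \<circ> F) = - sign_on X (E0 \<circ> E)"
    proof (rule sign_on_half_transpose[of _ x w])
      fix z assume z: "z \<in> X"
      then have "z \<in> P" using X_sub by auto
      then show "F z = (if x \<in> X then E (transpose x w z) else transpose x w (E z))"
        using z xy u w uw wx False Ez[of z] u_def w_def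
        by (auto simp: F_def transpose_def)
    qed (use Ec xy w wx in auto)
    ultimately show ?thesis using turn by (auto simp: total_sign_def)
  qed
  then show ?thesis unfolding T_def y_def .
qed

text \<open>The arcs of V on which S and T disagree are reversed one by one. Each reversal may
  replace E by another joining, which is harmless since \<open>total_sign_same_set\<close> compares
  arbitrary joinings at the end.\<close>

lemma total_sign_eq:
  assumes "configuration E S" "configuration F T"
  shows "total_sign E S = total_sign F T"
  using assms(1)
proof (induction "card (S - T)" arbitrary: E S rule: less_induct)
  case less
  have S: "S \<subseteq> P" "alternating P V S" and T: "T \<subseteq> P" "alternating P V T"
    using less.prems assms(2) by (auto simp: configuration_def alternating_def)
  show ?case
  proof (cases "S \<subseteq> T")
    case True
    \<comment> \<open>Both sets choose one end of each arc of V, so inclusion forces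
      equality.\<close>
    have "x \<in> S" if "x \<in> T" for x
    proof (rule ccontr)
      assume "x \<notin> S"
      moreover have "x \<in> P" using that T by auto
      ultimately have "V x \<in> S" "V x \<notin> T" using S T that by (auto simp: alternating_def)
      then show False using True by auto
    qed
    then have "S = T" using True by auto
    then show ?thesis using total_sign_same_set[OF assms(2)] less.prems by blast
  next
    case False
    then obtain x where x: "x \<in> S" "x \<notin> T" by auto
    define S' where "S' = insert (V x) (S - {x})"
    have "\<exists>E'. configuration E' S' \<and> total_sign E' S' = total_sign E S"
      using flip_turn[OF less.prems x(1)] flip_through[OF less.prems x(1)] unfolding S'_def by blast
    then obtain E' where E': "configuration E' S'" "total_sign E' S' = total_sign E S" by blast
    have "V x \<in> T" using x S(1) T(2) by (auto simp: alternating_def)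
    then have "S' - T = (S - T) - {x}" by (auto simp: S'_def)
    then have "card (S' - T) < card (S - T)"
      using x S(1) finite_P by (metis DiffI card_Diff1_less finite_Diff finite_subset)
    then show ?thesis using less.hyps E' by metis
  qed
qed

lemma total_sign_constant:
  "\<exists>\<mu>\<in>{1, -1}. \<forall>E S. configuration E S \<longrightarrow> total_sign E S = \<mu>"
proof (cases "\<exists>E S. configuration E S")
  case True
  then obtain E S where ES: "configuration E S" by blast
  have "\<bar>\<Prod>x\<in>A. if Q x then 1 else -1 :: int\<bar> = 1" for A :: "'a set" and Q
    by (induction A rule: infinite_finite_induct) (auto simp: abs_mult)
  then have "\<bar>turn_sign S\<bar> = 1" by (simp add: turn_sign_def)
  then have "\<bar>total_sign E S\<bar> = 1"
    by (simp add: total_sign_def abs_mult sign_on_def)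
  then have "total_sign E S \<in> {1, -1}" by auto
  then show ?thesis using total_sign_eq[OF _ ES] by blast
qed auto

text \<open>For fixed E with N curves, all 2 ^ N directions S have the same turning sign, equal to
  (-1) ^ N times the edge sign up to a global constant. Summing over S turns (-1) ^ N into (-2) ^ N.
  The order of quantifiers lets \<mu> leave the sum over edge permutations.\<close>

lemma sign_curves_eq_sum_turn_sign:
  "\<exists>\<mu>\<in>{1, -1}. \<forall>E. matching P E \<longrightarrow> alternating P E X \<longrightarrow>
    sign_on X (E0 \<circ> E) * (-2) ^ matching_curves P V E = \<mu> * (\<Sum>S | configuration E S. turn_sign S)"
proof -
  obtain \<mu> where \<mu>: "\<mu> \<in> {1, -1}" "\<And>E S. configuration E S \<Longrightarrow> total_sign E S = \<mu>"
    using total_sign_constant by blast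
  have turn: "turn_sign S * turn_sign S = 1" for S
    unfolding turn_sign_def prod.distrib[symmetric] by (rule prod.neutral) auto
  have "sign_on X (E0 \<circ> E) * (-2) ^ matching_curves P V E =
      (-1) ^ card P * \<mu> * (\<Sum>S | configuration E S. turn_sign S)"
    if E: "matching P E" "alternating P E X" for E
  proof -
    let ?N = "matching_curves P V E" and ?r = "sign_on X (E0 \<circ> E)"
    have conf: "{S. configuration E S} = {S. alternating P V S \<and> alternating P E S}"
      using E by (auto simp: configuration_def)
    have "?r * (-1) ^ ?N = (-1) ^ card P * \<mu> * turn_sign S" if S: "configuration E S" for S
    proof -
      have "sign_on P (traverse V E S) = (-1) ^ card P * (-1) ^ ?N"
        using S sign_traverse[OF finite_P V] by (simp add: configuration_def power_add)
      then have "(-1) ^ card P * (-1) ^ ?N * ?r * turn_sign S = \<mu>"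
        using \<mu>(2)[OF S] by (simp add: total_sign_def)
      moreover have "(-1) ^ card P * (-1) ^ card P = (1 :: int)" by (simp flip: power_add)
      moreover have "r * n = p * m * t" if "p * n * r * t = m" "p * p = 1" "t * t = 1"
        for r n p m t :: int
      proof -
        have "p * m * t = (p * p) * (t * t) * (r * n)" by (simp flip: that(1))
        then show ?thesis using that by simp
      qed
      ultimately show ?thesis using turn by blast
    qed
    then have "(\<Sum>S | configuration E S. ?r * (-1) ^ ?N) =
        (\<Sum>S | configuration E S. (-1) ^ card P * \<mu> * turn_sign S)"
      by (intro sum.cong) auto
    then have "int (card {S. configuration E S}) * (?r * (-1) ^ ?N) =
        (-1) ^ card P * \<mu> * (\<Sum>S | configuration E S. turn_sign S)"
      by (simp add: sum_distrib_left)
    moreover have "int (card {S. configuration E S}) * (-1) ^ ?N = (-2) ^ ?N"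
      using card_alternating[OF finite_P V E(1)] by (simp add: conf flip: power_mult_distrib)
    ultimately show ?thesis by (metis mult.left_commute)
  qed
  moreover have "(-1) ^ card P * \<mu> \<in> {1, -1}"
    using \<mu>(1) by (cases "even (card P)") auto
  ultimately show ?thesis by blast
qed

end

section \<open>The strands of a spin network\<close>

lemma sign_on_Sigma:
  assumes "finite A" "\<And>h. h \<in> A \<Longrightarrow> finite (B h)" "\<And>h. h \<in> A \<Longrightarrow> bij_betw (f h) (B h) (B h)"
  shows "sign_on (Sigma A B) (\<lambda>(h, i). (h, f h i)) = (\<Prod>h\<in>A. sign_on (B h) (f h)) \<and>
    bij_betw (\<lambda>(h, i). (h, f h i)) (Sigma A B) (Sigma A B)"
  using assms
proof (induction A rule: finite_induct)
  case empty
  have "restrict_id g {} = id" for g :: "'a \<times> 'b \<Rightarrow> 'a \<times> 'b" by (auto simp: restrict_id_def)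
  then show ?case by (simp add: sign_on_def bij_betw_def)
next
  case (insert h A)
  let ?f = "\<lambda>(h, i). (h, f h i)"
  have IH: "sign_on (Sigma A B) ?f = (\<Prod>h\<in>A. sign_on (B h) (f h))"
    "bij_betw ?f (Sigma A B) (Sigma A B)"
    using insert by auto
  have h: "bij_betw (f h) (B h) (B h)" "finite (B h)" using insert by auto
  have pair: "bij_betw (Pair h) (B h) ({h} \<times> B h)" by (auto simp: bij_betw_def inj_on_def)
  have "sign_on ({h} \<times> B h) ?f = sign_on (B h) (f h)"
    by (rule sign_on_conjugate[OF h(2) pair h(1)]) auto
  moreover have "?f ` ({h} \<times> B h) = {h} \<times> f h ` B h" by force
  then have "bij_betw ?f ({h} \<times> B h) ({h} \<times> B h)"
    using h(1) by (auto simp: bij_betw_def inj_on_def)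
  moreover have "Sigma (insert h A) B = {h} \<times> B h \<union> Sigma A B" "({h} \<times> B h) \<inter> Sigma A B = {}"
    using insert.hyps by auto
  ultimately show ?case
    using IH h insert sign_on_Un[of "{h} \<times> B h" "Sigma A B" ?f]
    by (auto intro!: bij_betw_combine)
qed

text \<open>This is the permutation seen at an outgoing half-edge that is not the representative of
  its edge: read backwards, with the strand order reversed at both ends.\<close>

lemma sign_on_reversed_inverse:
  fixes n :: nat
  assumes "p permutes {..<n}"
  shows "sign_on {..<n} (\<lambda>i. n - 1 - inv p (n - 1 - i)) = sign p"
proof -
  have rev: "bij_betw (\<lambda>i. n - 1 - i) {..<n} {..<n}"
    by (rule bij_betw_byWitness[where f' = "\<lambda>i. n - 1 - i"]) auto
  have "sign_on {..<n} (\<lambda>i. n - 1 - inv p (n - 1 - i)) = sign_on {..<n} (inv p)"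
    using permutes_imp_bij[OF permutes_inv[OF assms]]
    by (intro sign_on_conjugate[OF _ rev]) auto
  also have "\<dots> = sign (inv p)"
    using permutes_inv[OF assms] by (rule sign_on_permutes) simp
  finally show ?thesis
    using sign_inverse permutes_imp_permutation[OF _ assms] by auto
qed

locale spin_network =
  fixes H :: "'d set" and \<iota> \<rho> :: "'d \<Rightarrow> 'd" and \<gamma> :: "'d set \<Rightarrow> nat"
    and out :: "'d \<Rightarrow> bool" and \<tau> :: "'d set \<Rightarrow> 'd \<times> 'd"
  assumes cubic: "cubic_ribbon_graph H \<iota> \<rho>"
    and admissible: "admissible H \<iota> \<rho> \<gamma>"
    and smooth: "smooth_orientation H \<iota> \<rho> out"
    and signage: "gate_signage H \<rho> out \<tau>"
begin

abbreviation "d \<equiv> hdec \<iota> \<gamma>"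
abbreviation "edge \<equiv> edge_of \<iota>"
abbreviation "V \<equiv> vertex_match \<iota> \<rho> \<gamma>"
abbreviation "P \<equiv> strand_points H \<iota> \<gamma>"
abbreviation "g1 v \<equiv> fst (\<tau> v)"
abbreviation "g2 v \<equiv> snd (\<tau> v)"
abbreviation "g0 v \<equiv> third_he out v"

definition X :: "('d \<times> nat) set" where
  "X = {x \<in> P. out (fst x)}"

text \<open>These strands carry the factors \<epsilon> of the vertex tensor. Taking the end at the
  first gate half-edge fixes the sign of the antisymmetric \<epsilon>.\<close>

definition G_at :: "'d set \<Rightarrow> nat set" where
  "G_at v = {i. i < d (g1 v) \<and> fst (V (g1 v, i)) = g2 v}"

definition G :: "('d \<times> nat) set" where
  "G = (\<lambda>(v, i). (g1 v, i)) ` Sigma (vertices H \<rho>) G_at"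

lemma finite_H: "finite H"
  using cubic by (simp add: cubic_ribbon_graph_def)

lemma \<iota>: "h \<in> H \<Longrightarrow> \<iota> h \<in> H" "h \<in> H \<Longrightarrow> \<iota> (\<iota> h) = h" "h \<in> H \<Longrightarrow> \<iota> h \<noteq> h"
  using cubic by (auto simp: cubic_ribbon_graph_def permutes_in_image)

lemma \<rho>: "h \<in> H \<Longrightarrow> \<rho> h \<in> H" "h \<in> H \<Longrightarrow> \<rho> (\<rho> (\<rho> h)) = h" "h \<in> H \<Longrightarrow> \<rho> h \<noteq> h"
  "h \<in> H \<Longrightarrow> \<rho> (\<rho> h) \<noteq> h" "h \<in> H \<Longrightarrow> \<rho> (\<rho> h) \<noteq> \<rho> h"
proof -
  show *: "h \<in> H \<Longrightarrow> \<rho> h \<in> H" "h \<in> H \<Longrightarrow> \<rho> (\<rho> (\<rho> h)) = h" "h \<in> H \<Longrightarrow> \<rho> h \<noteq> h" for h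
    using cubic by (auto simp: cubic_ribbon_graph_def permutes_in_image)
  then show "h \<in> H \<Longrightarrow> \<rho> (\<rho> h) \<noteq> h" "h \<in> H \<Longrightarrow> \<rho> (\<rho> h) \<noteq> \<rho> h" by metis+
qed

lemma out_\<iota>: "h \<in> H \<Longrightarrow> out (\<iota> h) \<longleftrightarrow> \<not> out h"
  using smooth by (simp add: smooth_orientation_def)

lemma edge_\<iota>: "h \<in> H \<Longrightarrow> edge (\<iota> h) = edge h"
  using \<iota>(2) by (auto simp: edge_of_def)

lemma edge_in: "h \<in> H \<Longrightarrow> edge h \<in> edges H \<iota>"
  by (simp add: edges_def)

lemma d_\<iota>: "h \<in> H \<Longrightarrow> d (\<iota> h) = d h"
  by (simp add: hdec_def edge_\<iota>)

lemma finite_P: "finite P"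
proof -
  have "P = Sigma H (\<lambda>h. {..<d h})" by (auto simp: strand_points_def)
  then show ?thesis using finite_H by auto
qed

lemma P_iff: "(h, i) \<in> P \<longleftrightarrow> h \<in> H \<and> i < d h"
  by (simp add: strand_points_def)

lemma rep_cases:
  assumes "h \<in> H"
  shows "edge_rep (edge h) = h \<or> edge_rep (edge h) = \<iota> h"
proof -
  have "edge_rep (edge h) \<in> edge h"
    unfolding edge_rep_def by (rule someI[of _ h]) (simp add: edge_of_def)
  then show ?thesis by (auto simp: edge_of_def)
qed

lemma edge_rep:
  assumes "e \<in> edges H \<iota>"
  shows "edge_rep e \<in> H" "edge (edge_rep e) = e" "edge (\<iota> (edge_rep e)) = e" "d (edge_rep e) = \<gamma> e"
proof -
  obtain h where h: "h \<in> H" "e = edge h" using assms by (auto simp: edges_def)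
  then show "edge_rep e \<in> H" "edge (edge_rep e) = e"
    using rep_cases[OF h(1)] \<iota> edge_\<iota> by auto
  then show "edge (\<iota> (edge_rep e)) = e" "d (edge_rep e) = \<gamma> e" by (simp_all add: edge_\<iota> hdec_def)
qed

text \<open>Parity and the triangle inequalities say exactly that the three numbers of joined
  strands are natural. Writing the decorations as their sums removes halves and truncated
  subtractions from the joining.\<close>

lemma strand_numbers:
  assumes "h \<in> H"
  obtains p q r where "d h = p + q" "d (\<rho> h) = p + r" "d (\<rho> (\<rho> h)) = q + r"
proof -
  define a b c where "a = d h" and "b = d (\<rho> h)" and "c = d (\<rho> (\<rho> h))"
  have *: "even (a + b + c)" "\<bar>int a - int b\<bar> \<le> int c" "c \<le> a + b"
    using admissible assms by (auto simp: admissible_def Let_def a_def b_def c_def)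
  then obtain s where s: "a + b + c = 2 * s" by blast
  have "a = (s - c) + (s - b)" "b = (s - c) + (s - a)" "c = (s - b) + (s - a)"
    using * s by linarith+
  then show ?thesis using that unfolding a_def b_def c_def by blast
qed

lemma V_eq:
  assumes "d h = p + q" "d (\<rho> h) = p + r" "d (\<rho> (\<rho> h)) = q + r"
  shows "V (h, i) = (if i < q then (\<rho> (\<rho> h), q + r - 1 - i) else (\<rho> h, p + q - 1 - i))"
  using assms by (simp add: vertex_match_def Let_def)

lemma matching_V: "matching P V"
  unfolding matching_def
proof
  fix x assume "x \<in> P"
  then obtain h i where x: "x = (h, i)" "h \<in> H" "i < d h" by (auto simp: strand_points_def)
  obtain p q r where n: "d h = p + q" "d (\<rho> h) = p + r" "d (\<rho> (\<rho> h)) = q + r"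
    using strand_numbers[OF x(2)] .
  note \<rho>h = \<rho>[OF x(2)]
  \<comment> \<open>Moving to the next half-edge rotates the three strand numbers, so one formula
    serves all three half-edges.\<close>
  have V: "V (h, j) = (if j < q then (\<rho> (\<rho> h), q + r - 1 - j) else (\<rho> h, p + q - 1 - j))"
    "V (\<rho> h, j) = (if j < p then (h, q + p - 1 - j) else (\<rho> (\<rho> h), r + p - 1 - j))"
    "V (\<rho> (\<rho> h), j) = (if j < r then (\<rho> h, p + r - 1 - j) else (h, q + r - 1 - j))" for j
    using V_eq[of h p q r] V_eq[of "\<rho> h" r p q] V_eq[of "\<rho> (\<rho> h)" q r p] n \<rho>h
    by (simp_all add: add.commute)
  show "V x \<in> P \<and> V (V x) = x \<and> V x \<noteq> x"
    using x n \<rho>h \<rho>(1) V by (auto simp: P_iff)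
qed

definition strand_perms :: "('d set \<Rightarrow> nat \<Rightarrow> nat) \<Rightarrow> bool" where
  "strand_perms \<sigma> \<longleftrightarrow> (\<forall>e\<in>edges H \<iota>. \<sigma> e permutes {..<\<gamma> e})"

lemma strand_permsD:
  assumes "strand_perms \<sigma>" "h \<in> H"
  shows "\<sigma> (edge h) permutes {..<d h}"
    "\<sigma> (edge h) i < d h \<longleftrightarrow> i < d h" "inv (\<sigma> (edge h)) i < d h \<longleftrightarrow> i < d h"
    "\<sigma> (edge h) (inv (\<sigma> (edge h)) i) = i" "inv (\<sigma> (edge h)) (\<sigma> (edge h) i) = i"
proof -
  show *: "\<sigma> (edge h) permutes {..<d h}"
    using assms by (auto simp: strand_perms_def edges_def hdec_def)
  show "\<sigma> (edge h) i < d h \<longleftrightarrow> i < d h" "inv (\<sigma> (edge h)) i < d h \<longleftrightarrow> i < d h"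
    using permutes_in_image[OF *, of i] permutes_in_image[OF permutes_inv[OF *], of i] by auto
  show "\<sigma> (edge h) (inv (\<sigma> (edge h)) i) = i" "inv (\<sigma> (edge h)) (\<sigma> (edge h) i) = i"
    using permutes_inverses[OF *] by auto
qed

lemma edge_match_eq:
  "edge_match \<iota> \<gamma> \<sigma> (h, i) = (\<iota> h, if h = edge_rep (edge h) then d h - 1 - \<sigma> (edge h) i
     else inv (\<sigma> (edge h)) (d h - 1 - i))"
  by (simp add: edge_match_def Let_def hdec_def)

lemma matching_edge_match:
  assumes "strand_perms \<sigma>"
  shows "matching P (edge_match \<iota> \<gamma> \<sigma>)"
  unfolding matching_def
proof
  fix x assume "x \<in> P"
  then obtain h i where x: "x = (h, i)" "h \<in> H" "i < d h" by (auto simp: strand_points_def)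
  note \<iota>h = \<iota>[OF x(2)] and \<sigma> = strand_permsD[OF assms x(2)]
  have "\<sigma> (edge h) i < d h" using \<sigma>(2) x by simp
  then have rev: "d h - Suc (d h - Suc (\<sigma> (edge h) i)) = \<sigma> (edge h) i" by simp
  let ?E = "edge_match \<iota> \<gamma> \<sigma>"
  from rep_cases[OF x(2)] show "?E x \<in> P \<and> ?E (?E x) = x \<and> ?E x \<noteq> x"
  proof
    assume "edge_rep (edge h) = h"
    then have "?E (h, j) = (\<iota> h, d h - 1 - \<sigma> (edge h) j)"
      "?E (\<iota> h, j) = (h, inv (\<sigma> (edge h)) (d h - 1 - j))" for j
      using \<iota>h d_\<iota>[OF x(2)] edge_\<iota>[OF x(2)] by (simp_all add: edge_match_eq)
    then show ?thesis using x \<iota>h \<sigma> rev d_\<iota>[OF x(2)] by (simp add: P_iff)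
  next
    assume "edge_rep (edge h) = \<iota> h"
    then have "?E (h, j) = (\<iota> h, inv (\<sigma> (edge h)) (d h - 1 - j))"
      "?E (\<iota> h, j) = (h, d h - 1 - \<sigma> (edge h) j)" for j
      using \<iota>h d_\<iota>[OF x(2)] edge_\<iota>[OF x(2)] by (simp_all add: edge_match_eq)
    then show ?thesis using x \<iota>h \<sigma> d_\<iota>[OF x(2)] by (simp add: P_iff)
  qed
qed

lemma alternating_edge_match:
  assumes "strand_perms \<sigma>"
  shows "alternating P (edge_match \<iota> \<gamma> \<sigma>) X"
  unfolding alternating_def
proof (intro conjI ballI)
  show "X \<subseteq> P" by (auto simp: X_def)
  fix x assume x: "x \<in> P"
  then have "edge_match \<iota> \<gamma> \<sigma> x \<in> P" using matchingD(1)[OF matching_edge_match[OF assms]] by blast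
  moreover obtain h i where "x = (h, i)" by (cases x)
  ultimately show "edge_match \<iota> \<gamma> \<sigma> x \<in> X \<longleftrightarrow> x \<notin> X"
    using x by (auto simp: X_def edge_match_eq P_iff out_\<iota>)
qed

section \<open>The gate and the third half-edge at a vertex\<close>

lemma vertex_of_eqI:
  assumes "h \<in> H" "h' \<in> vertex_of \<rho> h"
  shows "vertex_of \<rho> h' = vertex_of \<rho> h"
  using assms \<rho>[OF assms(1)] by (auto simp: vertex_of_def)

lemma vertex_cases:
  assumes "v \<in> vertices H \<rho>"
  shows "v = {g1 v, g2 v, g0 v}" "g1 v \<in> H"
    "g2 v = \<rho> (g1 v) \<and> g0 v = \<rho> (g2 v) \<or> g1 v = \<rho> (g2 v) \<and> g0 v = \<rho> (g1 v)"
    "out (g2 v) = out (g1 v)" "out (g0 v) \<noteq> out (g1 v)"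
proof -
  obtain h where h: "h \<in> H" "v = {h, \<rho> h, \<rho> (\<rho> h)}"
    using assms by (auto simp: vertices_def vertex_of_def)
  note \<rho>h = \<rho>[OF h(1)]
  have g: "g1 v \<in> gate out v" "g2 v \<in> gate out v" "g1 v \<noteq> g2 v"
    using signage assms by (auto simp: gate_signage_def)
  have ne: "\<not> (out h = out (\<rho> h) \<and> out (\<rho> h) = out (\<rho> (\<rho> h)))"
    using smooth h(1) by (auto simp: smooth_orientation_def)
  \<comment> \<open>The half-edge whose direction differs from the other two; smoothness guarantees
    that there is one.\<close>
  define k where "k = (if out h = out (\<rho> h) then \<rho> (\<rho> h) else if out h = out (\<rho> (\<rho> h)) then \<rho> h else h)"
  have gate: "gate out v = v - {k}"
    using \<rho>h ne unfolding gate_def h(2) k_def by auto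
  have k: "k \<in> v" by (auto simp: k_def h(2))
  have g0: "g0 v = k"
    unfolding third_he_def gate using k by (intro the_equality) auto
  have vk: "v = {k, \<rho> k, \<rho> (\<rho> k)}" "\<rho> (\<rho> (\<rho> k)) = k" "k \<in> H"
    using \<rho>h h \<rho>(1) by (auto simp: k_def)
  have ok: "out (\<rho> k) \<noteq> out k" "out (\<rho> (\<rho> k)) \<noteq> out k"
    using \<rho>h ne by (auto simp: k_def)
  have mem: "x = \<rho> k \<or> x = \<rho> (\<rho> k)" if "x \<in> gate out v" for x
    using that gate vk(1) by blast
  have gg: "g1 v = \<rho> k \<and> g2 v = \<rho> (\<rho> k) \<or> g1 v = \<rho> (\<rho> k) \<and> g2 v = \<rho> k"
    using mem[OF g(1)] mem[OF g(2)] g(3) by auto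
  have "{k, \<rho> k, \<rho> (\<rho> k)} = {g1 v, g2 v, g0 v}"
    using gg by (elim disjE conjE) (simp only: g0, blast)+
  with vk(1) show "v = {g1 v, g2 v, g0 v}" by (rule trans)
  show "g1 v \<in> H" using gg vk(3) \<rho>(1) by metis
  show "g2 v = \<rho> (g1 v) \<and> g0 v = \<rho> (g2 v) \<or> g1 v = \<rho> (g2 v) \<and> g0 v = \<rho> (g1 v)"
    using gg g0 vk(2) by auto
  show "out (g2 v) = out (g1 v)" "out (g0 v) \<noteq> out (g1 v)" using gg g0 ok by auto
qed

lemma vertex_mem:
  assumes "v \<in> vertices H \<rho>"
  shows "h \<in> v \<longleftrightarrow> h = g1 v \<or> h = g2 v \<or> h = g0 v"
  using vertex_cases(1)[OF assms] by blast

lemma vertex_distinct: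
  assumes "v \<in> vertices H \<rho>"
  shows "g2 v \<in> H" "g0 v \<in> H" "g1 v \<noteq> g2 v" "g1 v \<noteq> g0 v" "g2 v \<noteq> g0 v"
proof -
  have v: "v \<subseteq> H" using assms \<rho>(1) by (auto simp: vertices_def vertex_of_def)
  then show "g2 v \<in> H" "g0 v \<in> H" using vertex_mem[OF assms] by auto
  show "g1 v \<noteq> g0 v" "g2 v \<noteq> g0 v" using vertex_cases(4,5)[OF assms] by auto
  show "g1 v \<noteq> g2 v" using signage assms by (auto simp: gate_signage_def)
qed

lemma vertex_unique:
  assumes "v \<in> vertices H \<rho>" "w \<in> vertices H \<rho>" "h \<in> v" "h \<in> w"
  shows "v = w"
proof -
  have "u = vertex_of \<rho> h" if "u \<in> vertices H \<rho>" "h \<in> u" for u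
    using that vertex_of_eqI unfolding vertices_def by blast
  then show ?thesis using assms by metis
qed

lemma fst_V:
  assumes "v \<in> vertices H \<rho>" "h \<in> v"
  shows "fst (V (h, i)) \<in> v - {h}"
proof -
  obtain k where k: "k \<in> H" "v = vertex_of \<rho> k" using assms(1) by (auto simp: vertices_def)
  then have "h \<in> H" "v = vertex_of \<rho> h"
    using assms(2) \<rho>(1) vertex_of_eqI[OF k(1), of h] by (auto simp: vertex_of_def)
  then show ?thesis using \<rho>[of h] by (auto simp: vertex_of_def vertex_match_def Let_def)
qed

lemma in_vertex: "h \<in> H \<Longrightarrow> h \<in> vertex_of \<rho> h \<and> vertex_of \<rho> h \<in> vertices H \<rho>"
  by (auto simp: vertices_def vertex_of_def)

lemma G_iff:
  assumes "v \<in> vertices H \<rho>" "h \<in> v"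
  shows "(h, i) \<in> G \<longleftrightarrow> i < d h \<and> h = g1 v \<and> fst (V (h, i)) = g2 v"
proof -
  have "w = v" if "w \<in> vertices H \<rho>" "h = g1 w" for w
    using vertex_unique[OF that(1) assms(1), of h] vertex_mem[OF that(1)] that(2) assms(2) by blast
  then show ?thesis using assms(1) by (auto simp: G_def G_at_def)
qed

text \<open>The reference joining inserts the identity on every edge. An arc on which the
  orientation turns must connect the two gate half-edges, and its end at the first of them is the
  one in G.\<close>

sublocale oriented_matching P X G V "edge_match \<iota> \<gamma> (\<lambda>_. id)"
proof
  have id: "strand_perms (\<lambda>_. id)" by (simp add: strand_perms_def permutes_id)
  show "matching P (edge_match \<iota> \<gamma> (\<lambda>_. id))" using id by (rule matching_edge_match)
  show "alternating P (edge_match \<iota> \<gamma> (\<lambda>_. id)) X" using id by (rule alternating_edge_match)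
  show "G \<subseteq> P" using vertex_cases(2) by (auto simp: G_def G_at_def P_iff)
  have *: "V x \<in> X \<longleftrightarrow> out (fst (V x))" "x \<in> X \<longleftrightarrow> out (fst x)" if "x \<in> P" for x
    using matchingD(1)[OF matching_V that] that by (auto simp: X_def)
  fix x
  show "V x \<in> X \<longleftrightarrow> x \<in> X" if x: "x \<in> G"
  proof -
    obtain v i where v: "v \<in> vertices H \<rho>" "x = (g1 v, i)" "i < d (g1 v)" "fst (V x) = g2 v"
      using x by (auto simp: G_def G_at_def)
    then have "x \<in> P" using vertex_cases(2) by (simp add: P_iff)
    then show ?thesis using * v vertex_cases(4) by simp
  qed
  show "V x \<in> G \<longleftrightarrow> x \<notin> G" if x: "x \<in> P" "V x \<in> X \<longleftrightarrow> x \<in> X"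
  proof -
    obtain h i where hi: "x = (h, i)" "h \<in> H" "i < d h" using x by (auto simp: strand_points_def)
    obtain h' i' where hi': "V x = (h', i')" by (cases "V x")
    define v where "v = vertex_of \<rho> h"
    have v: "v \<in> vertices H \<rho>" "h \<in> v" using in_vertex hi by (auto simp: v_def)
    have h': "h' \<in> v" "h' \<noteq> h" using fst_V[OF v, of i] hi' hi by auto
    have o: "out h' = out h" using x * hi hi' by auto
    have "i' < d h'" using matchingD(1)[OF matching_V x(1)] hi' by (simp add: P_iff)
    moreover have "V (h', i') = (h, i)" using matchingD(2)[OF matching_V x(1)] hi' hi by simp
    moreover have "h = g1 v \<and> h' = g2 v \<or> h = g2 v \<and> h' = g1 v"
      using v(2) h' o vertex_mem[OF v(1)] vertex_cases(4,5)[OF v(1)] by metis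
    ultimately show ?thesis
      using G_iff[OF v(1)] v h' hi hi' vertex_distinct[OF v(1)] by auto
  qed
qed (rule finite_P matching_V)+

lemma bij_betw_edge:
  "bij_betw edge {h \<in> H. out h} (edges H \<iota>)"
proof (rule bij_betw_imageI)
  show "inj_on edge {h \<in> H. out h}"
    using out_\<iota> by (auto simp: inj_on_def edge_of_def doubleton_eq_iff)
  have "edge h \<in> edge ` {h \<in> H. out h}" if h: "h \<in> H" for h
  proof (cases "out h")
    case False
    then have "\<iota> h \<in> {h \<in> H. out h}" using h out_\<iota> \<iota> by auto
    then have "edge (\<iota> h) \<in> edge ` {h \<in> H. out h}" by (rule imageI)
    then show ?thesis using edge_\<iota>[OF h] by simp
  qed (use h in auto)
  then show "edge ` {h \<in> H. out h} = edges H \<iota>" by (auto simp: edges_def)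
qed

text \<open>X splits into one slice for each outgoing half-edge, that is for each edge. A slice
  carries \<sigma> e or its reversed inverse, depending on whether the outgoing half-edge is the
  representative, and the sign is the same.\<close>

lemma sign_on_edge_match:
  assumes "strand_perms \<sigma>"
  shows "sign_on X (edge_match \<iota> \<gamma> (\<lambda>_. id) \<circ> edge_match \<iota> \<gamma> \<sigma>) = (\<Prod>e\<in>edges H \<iota>. sign (\<sigma> e))"
proof -
  define f where "f h i = (if h = edge_rep (edge h) then \<sigma> (edge h) i
    else d h - 1 - inv (\<sigma> (edge h)) (d h - 1 - i))" for h i
  have X: "X = Sigma {h \<in> H. out h} (\<lambda>h. {..<d h})"
    by (auto simp: X_def strand_points_def)
  have f: "bij_betw (f h) {..<d h} {..<d h} \<and> sign_on {..<d h} (f h) = sign (\<sigma> (edge h))"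
    if h: "h \<in> H" for h
  proof (cases "h = edge_rep (edge h)")
    case True
    then have "f h = \<sigma> (edge h)" by (simp add: f_def fun_eq_iff)
    then show ?thesis
      using permutes_imp_bij[OF strand_permsD(1)[OF assms h]]
        sign_on_permutes[OF strand_permsD(1)[OF assms h] subset_refl] by simp
  next
    case False
    note \<sigma> = strand_permsD[OF assms h]
    have f: "f h = (\<lambda>i. d h - 1 - inv (\<sigma> (edge h)) (d h - 1 - i))"
      using False by (simp add: f_def fun_eq_iff)
    have rev: "bij_betw (\<lambda>i. n - 1 - i) {..<n} {..<n}" for n :: nat
      by (rule bij_betw_byWitness[where f' = "\<lambda>i. n - 1 - i"]) auto
    have "bij_betw ((\<lambda>i. d h - 1 - i) \<circ> (inv (\<sigma> (edge h)) \<circ> (\<lambda>i. d h - 1 - i))) {..<d h} {..<d h}"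
      by (intro bij_betw_trans[OF _ rev] bij_betw_trans[OF rev] permutes_imp_bij permutes_inv \<sigma>)
    then show ?thesis
      using sign_on_reversed_inverse[OF \<sigma>(1)] by (simp add: f comp_def)
  qed
  have "sign_on X (edge_match \<iota> \<gamma> (\<lambda>_. id) \<circ> edge_match \<iota> \<gamma> \<sigma>) = sign_on X (\<lambda>(h, i). (h, f h i))"
  proof (intro sign_on_cong refl)
    fix x assume "x \<in> X"
    then obtain h i where x: "x = (h, i)" "h \<in> H" "i < d h" by (auto simp: X)
    have "\<sigma> (edge h) i < d h" using x strand_permsD(2)[OF assms x(2)] by simp
    then show "(edge_match \<iota> \<gamma> (\<lambda>_. id) \<circ> edge_match \<iota> \<gamma> \<sigma>) x = (case x of (h, i) \<Rightarrow> (h, f h i))"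
      using x \<iota>[OF x(2)] d_\<iota>[OF x(2)] by (simp add: edge_match_eq f_def)
  qed
  also have "\<dots> = (\<Prod>h | h \<in> H \<and> out h. sign_on {..<d h} (f h))"
    unfolding X using f finite_H by (intro sign_on_Sigma[THEN conjunct1]) auto
  also have "\<dots> = (\<Prod>h | h \<in> H \<and> out h. sign (\<sigma> (edge h)))"
    using f by (intro prod.cong) auto
  also have "\<dots> = (\<Prod>e\<in>edges H \<iota>. sign (\<sigma> e))"
    by (rule prod.reindex_bij_betw[OF bij_betw_edge])
  finally show ?thesis .
qed

lemma graph_curves_eq: "graph_curves H \<iota> \<rho> \<gamma> \<sigma> = matching_curves P V (edge_match \<iota> \<gamma> \<sigma>)"
  by (simp add: graph_curves_def matching_curves_def curve_rel_def)

lemma penrose_term: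
  "\<exists>\<mu>\<in>{1, -1}. \<forall>\<sigma>. strand_perms \<sigma> \<longrightarrow>
    (\<Prod>e\<in>edges H \<iota>. sign (\<sigma> e)) * (-2) ^ graph_curves H \<iota> \<rho> \<gamma> \<sigma> =
    \<mu> * (\<Sum>S | configuration (edge_match \<iota> \<gamma> \<sigma>) S. turn_sign S)"
proof -
  obtain \<mu> where "\<mu> \<in> {1, -1}" and \<mu>: "\<And>E. matching P E \<Longrightarrow> alternating P E X \<Longrightarrow>
      sign_on X (edge_match \<iota> \<gamma> (\<lambda>_. id) \<circ> E) * (-2) ^ matching_curves P V E =
      \<mu> * (\<Sum>S | configuration E S. turn_sign S)"
    using sign_curves_eq_sum_turn_sign by blast
  moreover have "(\<Prod>e\<in>edges H \<iota>. sign (\<sigma> e)) * (-2) ^ graph_curves H \<iota> \<rho> \<gamma> \<sigma> =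
      \<mu> * (\<Sum>S | configuration (edge_match \<iota> \<gamma> \<sigma>) S. turn_sign S)" if "strand_perms \<sigma>" for \<sigma>
    unfolding graph_curves_eq sign_on_edge_match[OF that, symmetric]
    using that by (intro \<mu> matching_edge_match alternating_edge_match)
  ultimately show ?thesis by blast
qed

end

section \<open>Sums over families of permutations\<close>

lemma sum_PiE_bij_betw:
  assumes "\<And>a. a \<in> A \<Longrightarrow> bij_betw (g a) (B a) (C a)"
  shows "(\<Sum>f\<in>Pi\<^sub>E A C. F f) = (\<Sum>f\<in>Pi\<^sub>E A B. F (\<lambda>a\<in>A. g a (f a)))"
proof -
  let ?k = "\<lambda>a. inv_into (B a) (g a)"
  have 1: "g a y \<in> C a" "?k a (g a y) = y" if "a \<in> A" "y \<in> B a" for a y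
    using assms[OF that(1)] that(2) by (auto simp: bij_betw_def)
  have 2: "?k a z \<in> B a" "g a (?k a z) = z" if "a \<in> A" "z \<in> C a" for a z
    using assms[OF that(1)] that(2)
    by (auto simp: bij_betw_def inv_into_into f_inv_into_f)
  show ?thesis
  proof (rule sum.reindex_bij_witness[where j = "\<lambda>f. \<lambda>a\<in>A. ?k a (f a)" and i = "\<lambda>f. \<lambda>a\<in>A. g a (f a)"])
    show *: "(\<lambda>a\<in>A. g a ((\<lambda>a\<in>A. ?k a (f a)) a)) = f" if "f \<in> Pi\<^sub>E A C" for f
      by (rule ext) (use 2 PiE_mem[OF that] PiE_arb[OF that] in \<open>auto simp: restrict_def\<close>)
    show "(\<lambda>a\<in>A. ?k a ((\<lambda>a\<in>A. g a (f a)) a)) = f" if "f \<in> Pi\<^sub>E A B" for f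
      by (rule ext) (use 1 PiE_mem[OF that] PiE_arb[OF that] in \<open>auto simp: restrict_def\<close>)
    show "F (\<lambda>a\<in>A. g a ((\<lambda>a\<in>A. ?k a (f a)) a)) = F f" if "f \<in> Pi\<^sub>E A C" for f
      unfolding *[OF that] ..
  qed (use 1 2 in \<open>auto simp: PiE_iff\<close>)
qed

lemma sum_PiE_insert:
  assumes "x \<notin> A"
  shows "(\<Sum>f\<in>Pi\<^sub>E (insert x A) T. F f) = (\<Sum>y\<in>T x. \<Sum>g\<in>Pi\<^sub>E A T. F (g(x := y)))"
proof -
  have "(\<Sum>f\<in>Pi\<^sub>E (insert x A) T. F f) = (\<Sum>(y, g)\<in>T x \<times> Pi\<^sub>E A T. F (g(x := y)))"
    unfolding PiE_insert_eq using inj_combinator[OF assms, of T]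
    by (subst sum.reindex) (auto simp: case_prod_unfold)
  then show ?thesis by (simp add: sum.cartesian_product)
qed

lemma sum_PiE_triple:
  assumes "x \<noteq> y" "x \<noteq> z" "y \<noteq> z"
  shows "(\<Sum>f\<in>Pi\<^sub>E {x, y, z} T. F (f x) (f y) (f z)) = (\<Sum>a\<in>T x. \<Sum>b\<in>T y. \<Sum>c\<in>T z. F a b c)"
  using assms by (simp add: sum_PiE_insert)

lemma sum_PiE_Un:
  assumes "A \<inter> B = {}"
  shows "(\<Sum>f\<in>Pi\<^sub>E (A \<union> B) T. F (restrict f A) (restrict f B)) = (\<Sum>f\<in>Pi\<^sub>E A T. \<Sum>g\<in>Pi\<^sub>E B T. F f g)"
  unfolding sum.cartesian_product
  by (rule sum.reindex_bij_witness[where j = "\<lambda>f. (restrict f A, restrict f B)"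
        and i = "\<lambda>(f, g) x. if x \<in> A then f x else g x"])
    (use assms in \<open>auto simp: PiE_def extensional_def restrict_def fun_eq_iff Pi_def\<close>)

text \<open>Distributivity, with families on disjoint blocks glued to one family on the union. The
  blocks will be the vertices as sets of half-edges.\<close>

lemma prod_sum_PiE_Union:
  fixes F :: "'a set \<Rightarrow> ('a \<Rightarrow> 'b) \<Rightarrow> 'c :: comm_semiring_1"
  assumes "finite \<V>" "\<And>v w. v \<in> \<V> \<Longrightarrow> w \<in> \<V> \<Longrightarrow> v \<noteq> w \<Longrightarrow> v \<inter> w = {}"
  shows "(\<Prod>v\<in>\<V>. \<Sum>f\<in>Pi\<^sub>E v T. F v f) = (\<Sum>f\<in>Pi\<^sub>E (\<Union>\<V>) T. \<Prod>v\<in>\<V>. F v (restrict f v))"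
  using assms
proof (induction \<V> rule: finite_induct)
  case empty
  then show ?case by simp
next
  case (insert v \<V>)
  have disj: "v \<inter> \<Union>\<V> = {}"
    using insert.prems insert.hyps(2) by blast
  have IH: "(\<Prod>w\<in>\<V>. \<Sum>f\<in>Pi\<^sub>E w T. F w f) = (\<Sum>f\<in>Pi\<^sub>E (\<Union>\<V>) T. \<Prod>w\<in>\<V>. F w (restrict f w))"
    by (rule insert.IH) (use insert.prems in auto)
  have "(\<Prod>w\<in>insert v \<V>. \<Sum>f\<in>Pi\<^sub>E w T. F w f) =
      (\<Sum>f\<in>Pi\<^sub>E v T. \<Sum>g\<in>Pi\<^sub>E (\<Union>\<V>) T. F v f * (\<Prod>w\<in>\<V>. F w (restrict g w)))"
    by (simp only: prod.insert[OF insert.hyps] IH sum_product)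
  also have "\<dots> = (\<Sum>f\<in>Pi\<^sub>E (v \<union> \<Union>\<V>) T. F v (restrict f v) * (\<Prod>w\<in>\<V>. F w (restrict (restrict f (\<Union>\<V>)) w)))"
    by (rule sum_PiE_Un[OF disj, symmetric])
  also have "\<dots> = (\<Sum>f\<in>Pi\<^sub>E (\<Union>(insert v \<V>)) T. \<Prod>w\<in>insert v \<V>. F w (restrict f w))"
  proof (rule sum.cong)
    fix f :: "'a \<Rightarrow> 'b"
    have "restrict (restrict f (\<Union>\<V>)) w = restrict f w" if "w \<in> \<V>" for w
      using that by (auto simp: restrict_def fun_eq_iff)
    then show "F v (restrict f v) * (\<Prod>w\<in>\<V>. F w (restrict (restrict f (\<Union>\<V>)) w)) =
        (\<Prod>w\<in>insert v \<V>. F w (restrict f w))"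
      using insert.hyps by simp
  qed simp
  finally show ?case .
qed

section \<open>Renumbering strands under symmetrisation\<close>

lemma sum_perms_of_compose:
  assumes "\<omega> \<in> perms_of n"
  shows "(\<Sum>\<pi>\<in>perms_of n. F \<pi>) = (\<Sum>\<pi>\<in>perms_of n. F (\<pi> \<circ> \<omega>))"
  using sum_permutations_compose_right assms unfolding perms_of_def by blast

lemma sum_perms_of_compose3:
  assumes "\<omega> \<in> perms_of a" "\<omega>' \<in> perms_of b" "\<omega>'' \<in> perms_of c"
  shows "(\<Sum>\<alpha>\<in>perms_of a. \<Sum>\<beta>\<in>perms_of b. \<Sum>\<kappa>\<in>perms_of c. F \<alpha> \<beta> \<kappa>) =
    (\<Sum>\<alpha>\<in>perms_of a. \<Sum>\<beta>\<in>perms_of b. \<Sum>\<kappa>\<in>perms_of c. F (\<alpha> \<circ> \<omega>) (\<beta> \<circ> \<omega>') (\<kappa> \<circ> \<omega>''))"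
proof -
  have "(\<Sum>\<alpha>\<in>perms_of a. \<Sum>\<beta>\<in>perms_of b. \<Sum>\<kappa>\<in>perms_of c. F \<alpha> \<beta> \<kappa>) =
      (\<Sum>\<alpha>\<in>perms_of a. \<Sum>\<beta>\<in>perms_of b. \<Sum>\<kappa>\<in>perms_of c. F (\<alpha> \<circ> \<omega>) \<beta> \<kappa>)"
    by (rule sum_perms_of_compose[OF assms(1)])
  also have "\<dots> = (\<Sum>\<alpha>\<in>perms_of a. \<Sum>\<beta>\<in>perms_of b. \<Sum>\<kappa>\<in>perms_of c. F (\<alpha> \<circ> \<omega>) (\<beta> \<circ> \<omega>') \<kappa>)"
    by (rule sum.cong[OF refl], rule sum_perms_of_compose[OF assms(2)])
  also have "\<dots> = (\<Sum>\<alpha>\<in>perms_of a. \<Sum>\<beta>\<in>perms_of b. \<Sum>\<kappa>\<in>perms_of c.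
      F (\<alpha> \<circ> \<omega>) (\<beta> \<circ> \<omega>') (\<kappa> \<circ> \<omega>''))"
    by (rule sum.cong[OF refl], rule sum.cong[OF refl], rule sum_perms_of_compose[OF assms(3)])
  finally show ?thesis .
qed

definition rev_perm :: "nat \<Rightarrow> nat \<Rightarrow> nat" where
  "rev_perm n i = (if i < n then n - 1 - i else i)"

lemma rev_perm: "rev_perm n \<in> perms_of n"
  unfolding perms_of_def mem_Collect_eq
  by (rule bij_imp_permutes, rule bij_betw_byWitness[where f' = "rev_perm n"])
    (auto simp: rev_perm_def)

lemma id_perms_of: "id \<in> perms_of n"
  by (simp add: perms_of_def permutes_id)

text \<open>The Penrose joining numbers the strands of all three half-edges counterclockwise, while
  \<open>T_v\<close> uses its own numbering; the symmetrisation absorbs the difference.\<close>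

lemma sum_T_v_counterclockwise:
  "(\<Sum>\<alpha>\<in>perms_of (p + q). \<Sum>\<beta>\<in>perms_of (p + r). \<Sum>\<kappa>\<in>perms_of (q + r).
      T_v (p + q) (p + r) (q + r) (I \<circ> \<alpha>) (J \<circ> \<beta>) (K \<circ> \<kappa>)) =
   (\<Sum>\<alpha>\<in>perms_of (p + q). \<Sum>\<beta>\<in>perms_of (p + r). \<Sum>\<kappa>\<in>perms_of (q + r).
      (\<Prod>t<p. eps (I (\<alpha> (q + p - 1 - t))) (J (\<beta> t))) *
      (\<Prod>t<q. kdelta (I (\<alpha> (q - 1 - t))) (K (\<kappa> (r + t)))) *
      (\<Prod>t<r. kdelta (J (\<beta> (p + t))) (K (\<kappa> (r - 1 - t)))))"
proof -
  \<comment> \<open>At the third half-edge the q strands towards the first gate half-edge come last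
    counterclockwise, and the r strands towards the second come first, in reversed order.\<close>
  define \<omega> where "\<omega> = (\<lambda>t. if t < q then r + t else if t < q + r then q + r - 1 - t else t)"
  have "\<omega> \<in> perms_of (q + r)"
    unfolding perms_of_def mem_Collect_eq
    by (rule bij_imp_permutes, rule bij_betw_byWitness[where
          f' = "\<lambda>k. if r \<le> k then k - r else q + r - 1 - k"])
      (auto simp: \<omega>_def)
  then show ?thesis
  proof (subst sum_perms_of_compose3[OF rev_perm id_perms_of], assumption, intro sum.cong refl)
    fix \<alpha> \<beta> \<kappa> :: "nat \<Rightarrow> nat"
    show "T_v (p + q) (p + r) (q + r) (I \<circ> (\<alpha> \<circ> rev_perm (p + q))) (J \<circ> (\<beta> \<circ> id)) (K \<circ> (\<kappa> \<circ> \<omega>)) =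
        (\<Prod>t<p. eps (I (\<alpha> (q + p - 1 - t))) (J (\<beta> t))) *
        (\<Prod>t<q. kdelta (I (\<alpha> (q - 1 - t))) (K (\<kappa> (r + t)))) *
        (\<Prod>t<r. kdelta (J (\<beta> (p + t))) (K (\<kappa> (r - 1 - t))))"
      unfolding T_v_def Let_def
      by (intro arg_cong2[of _ _ _ _ "(*)"] prod.cong) (auto simp: rev_perm_def \<omega>_def add.commute)
  qed
qed

text \<open>The mirror image, for a gate signage that runs against the cyclic order: now the second
  gate half-edge is reversed, and only the first q strands of the third.\<close>

lemma sum_T_v_clockwise:
  "(\<Sum>\<alpha>\<in>perms_of (p + q). \<Sum>\<beta>\<in>perms_of (p + r). \<Sum>\<kappa>\<in>perms_of (q + r).
      T_v (p + q) (p + r) (q + r) (I \<circ> \<alpha>) (J \<circ> \<beta>) (K \<circ> \<kappa>)) =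
   (\<Sum>\<alpha>\<in>perms_of (p + q). \<Sum>\<beta>\<in>perms_of (p + r). \<Sum>\<kappa>\<in>perms_of (q + r).
      (\<Prod>t<p. eps (I (\<alpha> t)) (J (\<beta> (r + p - 1 - t)))) *
      (\<Prod>t<q. kdelta (I (\<alpha> (p + t))) (K (\<kappa> (q - 1 - t)))) *
      (\<Prod>t<r. kdelta (J (\<beta> (r - 1 - t))) (K (\<kappa> (q + t)))))"
proof -
  have "rev_perm q \<in> perms_of (q + r)"
    using rev_perm[of q] permutes_subset[of "rev_perm q" "{..<q}" "{..<q + r}"] by (auto simp: perms_of_def)
  then show ?thesis
  proof (subst sum_perms_of_compose3[OF id_perms_of rev_perm], assumption, intro sum.cong refl)
    fix \<alpha> \<beta> \<kappa> :: "nat \<Rightarrow> nat"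
    show "T_v (p + q) (p + r) (q + r) (I \<circ> (\<alpha> \<circ> id)) (J \<circ> (\<beta> \<circ> rev_perm (p + r))) (K \<circ> (\<kappa> \<circ> rev_perm q)) =
        (\<Prod>t<p. eps (I (\<alpha> t)) (J (\<beta> (r + p - 1 - t)))) *
        (\<Prod>t<q. kdelta (I (\<alpha> (p + t))) (K (\<kappa> (q - 1 - t)))) *
        (\<Prod>t<r. kdelta (J (\<beta> (r - 1 - t))) (K (\<kappa> (q + t))))"
      unfolding T_v_def Let_def
      by (intro arg_cong2[of _ _ _ _ "(*)"] prod.cong) (auto simp: rev_perm_def add.commute)
  qed
qed

section \<open>Clebsch--Gordan tensors as products over arcs\<close>

lemma prod_lessThan_add:
  fixes f :: "nat \<Rightarrow> 'a :: comm_monoid_mult"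
  shows "(\<Prod>k<m + n. f k) = (\<Prod>k<m. f k) * (\<Prod>t<n. f (m + t))"
  by (induction n) (simp_all add: mult.assoc)

lemma kdelta_commute: "kdelta i j = kdelta j i"
  by (simp add: kdelta_def)

context spin_network
begin

text \<open>The tensor \<open>T_v\<close> written through the joining V. Every arc at v either
  connects the two gate half-edges or has exactly one end on the third half-edge, so each is counted
  once.\<close>

definition arc_weight :: "'d set \<Rightarrow> ('d \<times> nat \<Rightarrow> nat) \<Rightarrow> real" where
  "arc_weight v c = (\<Prod>i\<in>G_at v. eps (c (g1 v, i)) (c (V (g1 v, i)))) *
     (\<Prod>k<d (g0 v). kdelta (c (g0 v, k)) (c (V (g0 v, k))))"

lemma arc_weight_counterclockwise:
  assumes v: "v \<in> vertices H \<rho>" and \<rho>v: "g2 v = \<rho> (g1 v)" "g0 v = \<rho> (g2 v)"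
    and n: "d (g1 v) = p + q" "d (g2 v) = p + r" "d (g0 v) = q + r"
  shows "arc_weight v c = (\<Prod>t<p. eps (c (g1 v, q + p - 1 - t)) (c (g2 v, t))) *
    (\<Prod>t<q. kdelta (c (g1 v, q - 1 - t)) (c (g0 v, r + t))) *
    (\<Prod>t<r. kdelta (c (g2 v, p + t)) (c (g0 v, r - 1 - t)))"
proof -
  have \<rho>0: "\<rho> (g0 v) = g1 v" using \<rho>(2) vertex_cases(2)[OF v] \<rho>v by metis
  have V1: "V (g1 v, i) = (if i < q then (g0 v, q + r - 1 - i) else (g2 v, p + q - 1 - i))" for i
    using V_eq[of "g1 v" p q r] n \<rho>v by simp
  have V0: "V (g0 v, i) = (if i < r then (g2 v, r + p - 1 - i) else (g1 v, q + r - 1 - i))" for i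
    using V_eq[of "g0 v" q r p] n \<rho>v \<rho>0 by (simp add: add.commute)
  have G: "G_at v = {q..<p + q}"
    using V1 n vertex_distinct(5)[OF v] by (auto simp: G_at_def split: if_splits)
  have "(\<Prod>i\<in>G_at v. eps (c (g1 v, i)) (c (V (g1 v, i)))) =
      (\<Prod>t<p. eps (c (g1 v, q + p - 1 - t)) (c (g2 v, t)))"
    unfolding G by (rule prod.reindex_bij_witness[where i = "\<lambda>t. q + p - 1 - t" and j = "\<lambda>i. q + p - 1 - i"])
      (auto simp: V1 add.commute)
  moreover have "(\<Prod>k<d (g0 v). kdelta (c (g0 v, k)) (c (V (g0 v, k)))) =
      (\<Prod>k<r. kdelta (c (g0 v, k)) (c (g2 v, r + p - 1 - k))) *
      (\<Prod>t<q. kdelta (c (g0 v, r + t)) (c (g1 v, q - 1 - t)))"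
    unfolding n(3) add.commute[of q r] prod_lessThan_add
    by (intro arg_cong2[of _ _ _ _ "(*)"] prod.cong) (auto simp: V0)
  moreover have "(\<Prod>k<r. kdelta (c (g0 v, k)) (c (g2 v, r + p - 1 - k))) =
      (\<Prod>t<r. kdelta (c (g2 v, p + t)) (c (g0 v, r - 1 - t)))"
    by (rule prod.reindex_bij_witness[where i = "\<lambda>t. r - 1 - t" and j = "\<lambda>i. r - 1 - i"])
      (auto simp: kdelta_commute add.commute)
  moreover have "(\<Prod>t<q. kdelta (c (g0 v, r + t)) (c (g1 v, q - 1 - t))) =
      (\<Prod>t<q. kdelta (c (g1 v, q - 1 - t)) (c (g0 v, r + t)))"
    by (simp only: kdelta_commute)
  ultimately show ?thesis by (simp add: arc_weight_def)
qed

lemma arc_weight_clockwise: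
  assumes v: "v \<in> vertices H \<rho>" and \<rho>v: "g1 v = \<rho> (g2 v)" "g0 v = \<rho> (g1 v)"
    and n: "d (g1 v) = p + q" "d (g2 v) = p + r" "d (g0 v) = q + r"
  shows "arc_weight v c = (\<Prod>t<p. eps (c (g1 v, t)) (c (g2 v, r + p - 1 - t))) *
    (\<Prod>t<q. kdelta (c (g1 v, p + t)) (c (g0 v, q - 1 - t))) *
    (\<Prod>t<r. kdelta (c (g2 v, r - 1 - t)) (c (g0 v, q + t)))"
proof -
  have \<rho>0: "\<rho> (g0 v) = g2 v" using \<rho>(2) vertex_distinct(1)[OF v] \<rho>v by metis
  have V1: "V (g1 v, i) = (if i < p then (g2 v, p + r - 1 - i) else (g0 v, q + p - 1 - i))" for i
    using V_eq[of "g1 v" q p r] n \<rho>v \<rho>0 by (simp add: add.commute)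
  have V0: "V (g0 v, i) = (if i < q then (g1 v, q + p - 1 - i) else (g2 v, r + q - 1 - i))" for i
    using V_eq[of "g0 v" r q p] n \<rho>v \<rho>0 by (simp add: add.commute)
  have G: "G_at v = {..<p}"
    using V1 n vertex_distinct(5)[OF v] by (auto simp: G_at_def split: if_splits)
  have "(\<Prod>i\<in>G_at v. eps (c (g1 v, i)) (c (V (g1 v, i)))) =
      (\<Prod>t<p. eps (c (g1 v, t)) (c (g2 v, r + p - 1 - t)))"
    unfolding G by (intro prod.cong) (auto simp: V1 add.commute)
  moreover have "(\<Prod>k<d (g0 v). kdelta (c (g0 v, k)) (c (V (g0 v, k)))) =
      (\<Prod>k<q. kdelta (c (g0 v, k)) (c (g1 v, q + p - 1 - k))) *
      (\<Prod>t<r. kdelta (c (g0 v, q + t)) (c (g2 v, r - 1 - t)))"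
    unfolding n(3) prod_lessThan_add
    by (intro arg_cong2[of _ _ _ _ "(*)"] prod.cong) (auto simp: V0)
  moreover have "(\<Prod>k<q. kdelta (c (g0 v, k)) (c (g1 v, q + p - 1 - k))) =
      (\<Prod>t<q. kdelta (c (g1 v, p + t)) (c (g0 v, q - 1 - t)))"
    by (rule prod.reindex_bij_witness[where i = "\<lambda>t. q - 1 - t" and j = "\<lambda>i. q - 1 - i"])
      (auto simp: kdelta_commute add.commute)
  moreover have "(\<Prod>t<r. kdelta (c (g0 v, q + t)) (c (g2 v, r - 1 - t))) =
      (\<Prod>t<r. kdelta (c (g2 v, r - 1 - t)) (c (g0 v, q + t)))"
    by (simp only: kdelta_commute)
  ultimately show ?thesis by (simp add: arc_weight_def)
qed

lemma vertex_strand_numbers: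
  assumes v: "v \<in> vertices H \<rho>"
  obtains p q r where "d (g1 v) = p + q" "d (g2 v) = p + r" "d (g0 v) = q + r"
proof (cases "g2 v = \<rho> (g1 v) \<and> g0 v = \<rho> (g2 v)")
  case True
  moreover obtain p q r where "d (g1 v) = p + q" "d (\<rho> (g1 v)) = p + r" "d (\<rho> (\<rho> (g1 v))) = q + r"
    using strand_numbers[OF vertex_cases(2)[OF v]] .
  ultimately show ?thesis using that[of p q r] by simp
next
  case False
  then have "g1 v = \<rho> (g2 v)" "g0 v = \<rho> (\<rho> (g2 v))" using vertex_cases(3)[OF v] by auto
  moreover obtain p q r where "d (g2 v) = p + q" "d (\<rho> (g2 v)) = p + r" "d (\<rho> (\<rho> (g2 v))) = q + r"
    using strand_numbers[OF vertex_distinct(1)[OF v]] .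
  ultimately show ?thesis using that[of p r q] by simp
qed

text \<open>The three symmetrisations are packed into one family of permutations indexed by
  half-edges. At a loop the two half-edges keep separate permutations although they share a
  multi-index.\<close>

lemma W_v_eq_sum_arc_weight:
  assumes v: "v \<in> vertices H \<rho>"
  shows "W_v (d (g1 v)) (d (g2 v)) (d (g0 v)) (x (edge (g1 v))) (x (edge (g2 v))) (x (edge (g0 v))) =
    1 / (fact (d (g1 v)) * fact (d (g2 v)) * fact (d (g0 v))) *
    (\<Sum>\<pi>\<in>Pi\<^sub>E v (\<lambda>h. perms_of (d h)). arc_weight v (\<lambda>(h, i). x (edge h) (\<pi> h i)))"
proof -
  obtain p q r where n: "d (g1 v) = p + q" "d (g2 v) = p + r" "d (g0 v) = q + r"
    using vertex_strand_numbers[OF v] .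
  note ne = vertex_distinct(3-5)[OF v]
  let ?I = "x (edge (g1 v))" and ?J = "x (edge (g2 v))" and ?K = "x (edge (g0 v))"
  let ?T = "\<lambda>h. perms_of (d h)"
  have "(\<Sum>\<pi>\<in>Pi\<^sub>E {g1 v, g2 v, g0 v} ?T. arc_weight v (\<lambda>(h, i). x (edge h) (\<pi> h i))) =
      (\<Sum>\<alpha>\<in>perms_of (p + q). \<Sum>\<beta>\<in>perms_of (p + r). \<Sum>\<kappa>\<in>perms_of (q + r).
        T_v (p + q) (p + r) (q + r) (?I \<circ> \<alpha>) (?J \<circ> \<beta>) (?K \<circ> \<kappa>))"
  proof (cases "g2 v = \<rho> (g1 v) \<and> g0 v = \<rho> (g2 v)")
    case True
    let ?F = "\<lambda>\<alpha> \<beta> \<kappa>. (\<Prod>t<p. eps (?I (\<alpha> (q + p - 1 - t))) (?J (\<beta> t))) *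
      (\<Prod>t<q. kdelta (?I (\<alpha> (q - 1 - t))) (?K (\<kappa> (r + t)))) *
      (\<Prod>t<r. kdelta (?J (\<beta> (p + t))) (?K (\<kappa> (r - 1 - t))))"
    have "arc_weight v (\<lambda>(h, i). x (edge h) (\<pi> h i)) = ?F (\<pi> (g1 v)) (\<pi> (g2 v)) (\<pi> (g0 v))" for \<pi>
      using arc_weight_counterclockwise[OF v _ _ n] True by simp
    then have "(\<Sum>\<pi>\<in>Pi\<^sub>E {g1 v, g2 v, g0 v} ?T. arc_weight v (\<lambda>(h, i). x (edge h) (\<pi> h i))) =
        (\<Sum>\<pi>\<in>Pi\<^sub>E {g1 v, g2 v, g0 v} ?T. ?F (\<pi> (g1 v)) (\<pi> (g2 v)) (\<pi> (g0 v)))"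
      by (simp only:)
    also have "\<dots> = (\<Sum>\<alpha>\<in>?T (g1 v). \<Sum>\<beta>\<in>?T (g2 v). \<Sum>\<kappa>\<in>?T (g0 v). ?F \<alpha> \<beta> \<kappa>)"
      by (rule sum_PiE_triple[OF ne])
    finally show ?thesis by (simp only: sum_T_v_counterclockwise n)
  next
    case False
    then have *: "g1 v = \<rho> (g2 v)" "g0 v = \<rho> (g1 v)" using vertex_cases(3)[OF v] by blast+
    let ?F = "\<lambda>\<alpha> \<beta> \<kappa>. (\<Prod>t<p. eps (?I (\<alpha> t)) (?J (\<beta> (r + p - 1 - t)))) *
      (\<Prod>t<q. kdelta (?I (\<alpha> (p + t))) (?K (\<kappa> (q - 1 - t)))) *
      (\<Prod>t<r. kdelta (?J (\<beta> (r - 1 - t))) (?K (\<kappa> (q + t))))"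
    have "arc_weight v (\<lambda>(h, i). x (edge h) (\<pi> h i)) = ?F (\<pi> (g1 v)) (\<pi> (g2 v)) (\<pi> (g0 v))" for \<pi>
      using arc_weight_clockwise[OF v * n] by simp
    then have "(\<Sum>\<pi>\<in>Pi\<^sub>E {g1 v, g2 v, g0 v} ?T. arc_weight v (\<lambda>(h, i). x (edge h) (\<pi> h i))) =
        (\<Sum>\<pi>\<in>Pi\<^sub>E {g1 v, g2 v, g0 v} ?T. ?F (\<pi> (g1 v)) (\<pi> (g2 v)) (\<pi> (g0 v)))"
      by (simp only:)
    also have "\<dots> = (\<Sum>\<alpha>\<in>?T (g1 v). \<Sum>\<beta>\<in>?T (g2 v). \<Sum>\<kappa>\<in>?T (g0 v). ?F \<alpha> \<beta> \<kappa>)"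
      by (rule sum_PiE_triple[OF ne])
    finally show ?thesis by (simp only: sum_T_v_clockwise n)
  qed
  then show ?thesis
    unfolding vertex_cases(1)[OF v, symmetric] W_v_def n by simp
qed

lemma arc_weight_cong:
  assumes v: "v \<in> vertices H \<rho>" and c: "\<And>h i. h \<in> v \<Longrightarrow> i < d h \<Longrightarrow> c (h, i) = c' (h, i)"
  shows "arc_weight v c = arc_weight v c'"
proof -
  have V: "c (V (h, i)) = c' (V (h, i))" if "h \<in> v" "i < d h" for h i
  proof -
    have "h \<in> H" using that(1) vertex_mem[OF v] vertex_cases(2)[OF v] vertex_distinct[OF v] by auto
    then have "V (h, i) \<in> P" using that by (intro matchingD[OF matching_V]) (simp add: P_iff)
    moreover obtain h' i' where "V (h, i) = (h', i')" by (cases "V (h, i)")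
    ultimately show ?thesis using c fst_V[OF v that(1), of i] by (simp add: P_iff)
  qed
  have "g1 v \<in> v" "g0 v \<in> v" using vertex_mem[OF v] by auto
  then show ?thesis
    unfolding arc_weight_def using c V
    by (intro arg_cong2[of _ _ _ _ "(*)"] prod.cong refl arg_cong2[of _ _ _ _ eps]
        arg_cong2[of _ _ _ _ kdelta]) (auto simp: G_at_def)
qed

section \<open>The product over all vertices\<close>

definition weight :: "('d \<times> nat \<Rightarrow> nat) \<Rightarrow> real" where
  "weight c = (\<Prod>v\<in>vertices H \<rho>. arc_weight v c)"

lemma Union_vertices: "\<Union>(vertices H \<rho>) = H"
  using \<rho>(1) by (auto simp: vertices_def vertex_of_def)

lemma finite_vertices: "finite (vertices H \<rho>)"
  using finite_H by (simp add: vertices_def)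

lemma finite_edges: "finite (edges H \<iota>)"
  using finite_H by (simp add: edges_def)

lemma weight_cong:
  assumes "\<And>h i. h \<in> H \<Longrightarrow> i < d h \<Longrightarrow> c (h, i) = c' (h, i)"
  shows "weight c = weight c'"
proof -
  have "arc_weight v c = arc_weight v c'" if v: "v \<in> vertices H \<rho>" for v
    using v assms Union_vertices by (intro arc_weight_cong[OF v]) blast
  then show ?thesis by (simp add: weight_def)
qed

lemma prod_vertices:
  fixes f :: "'d \<Rightarrow> real"
  shows "(\<Prod>v\<in>vertices H \<rho>. f (g1 v) * f (g2 v) * f (g0 v)) = (\<Prod>h\<in>H. f h)"
proof -
  have "f (g1 v) * f (g2 v) * f (g0 v) = prod f v" if v: "v \<in> vertices H \<rho>" for v
  proof -
    have "prod f v = prod f {g1 v, g2 v, g0 v}"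
      by (rule arg_cong[OF vertex_cases(1)[OF v]])
    then show ?thesis using vertex_distinct[OF v] by (simp add: mult.assoc)
  qed
  then have "(\<Prod>v\<in>vertices H \<rho>. f (g1 v) * f (g2 v) * f (g0 v)) = (\<Prod>v\<in>vertices H \<rho>. prod f v)"
    by (intro prod.cong) auto
  also have "\<dots> = prod f (\<Union>(vertices H \<rho>))"
  proof (rule prod.Union_disjoint[symmetric, unfolded comp_def])
    show "\<forall>v\<in>vertices H \<rho>. finite v" by (auto simp: vertices_def vertex_of_def)
    show "\<forall>v\<in>vertices H \<rho>. \<forall>w\<in>vertices H \<rho>. v \<noteq> w \<longrightarrow> v \<inter> w = {}"
      using vertex_unique by blast
  qed
  finally show ?thesis by (simp add: Union_vertices)
qed

lemma prod_edges:
  fixes f :: "'d set \<Rightarrow> real"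
  shows "(\<Prod>h\<in>H. f (edge h)) = (\<Prod>e\<in>edges H \<iota>. f e) ^ 2"
proof -
  have "bij_betw \<iota> {h \<in> H. \<not> out h} {h \<in> H. out h}"
    by (rule bij_betw_byWitness[where f' = \<iota>]) (use \<iota> out_\<iota> in auto)
  then have "(\<Prod>h | h \<in> H \<and> \<not> out h. f (edge (\<iota> h))) = (\<Prod>h | h \<in> H \<and> out h. f (edge h))"
    by (rule prod.reindex_bij_betw)
  then have "(\<Prod>h | h \<in> H \<and> \<not> out h. f (edge h)) = (\<Prod>h | h \<in> H \<and> out h. f (edge h))"
    by (simp add: edge_\<iota>)
  moreover have "(\<Prod>h\<in>H. f (edge h)) =
      (\<Prod>h | h \<in> H \<and> out h. f (edge h)) * (\<Prod>h | h \<in> H \<and> \<not> out h. f (edge h))"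
    using finite_H by (subst prod.union_disjoint[symmetric]) (auto intro!: prod.cong)
  moreover have "(\<Prod>h | h \<in> H \<and> out h. f (edge h)) = (\<Prod>e\<in>edges H \<iota>. f e)"
    by (rule prod.reindex_bij_betw[OF bij_betw_edge])
  ultimately show ?thesis by (simp add: power2_eq_square)
qed

text \<open>Every edge has two half-edges, so the normalisations of all vertices together contain
  each edge factorial squared.\<close>

lemma prod_W_v:
  "(\<Prod>v\<in>vertices H \<rho>.
      W_v (d (g1 v)) (d (g2 v)) (d (g0 v)) (x (edge (g1 v))) (x (edge (g2 v))) (x (edge (g0 v)))) =
    (\<Sum>\<pi>\<in>Pi\<^sub>E H (\<lambda>h. perms_of (d h)). weight (\<lambda>(h, i). x (edge h) (\<pi> h i))) /
    (\<Prod>e\<in>edges H \<iota>. fact (\<gamma> e)) ^ 2"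
proof -
  let ?T = "\<lambda>h. perms_of (d h)" and ?c = "\<lambda>\<pi> (h, i). x (edge h) (\<pi> h i)"
  have "(\<Prod>v\<in>vertices H \<rho>. \<Sum>\<pi>\<in>Pi\<^sub>E v ?T. arc_weight v (?c \<pi>)) =
      (\<Sum>\<pi>\<in>Pi\<^sub>E H ?T. \<Prod>v\<in>vertices H \<rho>. arc_weight v (?c (restrict \<pi> v)))"
    using prod_sum_PiE_Union[OF finite_vertices, of "\<lambda>v \<pi>. arc_weight v (?c \<pi>)" ?T]
      vertex_unique unfolding Union_vertices by blast
  also have "\<dots> = (\<Sum>\<pi>\<in>Pi\<^sub>E H ?T. weight (?c \<pi>))"
  proof (rule sum.cong[OF refl])
    fix \<pi>
    have "arc_weight v (?c (restrict \<pi> v)) = arc_weight v (?c \<pi>)" if v: "v \<in> vertices H \<rho>" for v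
      by (rule arc_weight_cong[OF v]) simp
    then show "(\<Prod>v\<in>vertices H \<rho>. arc_weight v (?c (restrict \<pi> v))) = weight (?c \<pi>)"
      by (simp add: weight_def)
  qed
  finally have 1: "(\<Prod>v\<in>vertices H \<rho>. \<Sum>\<pi>\<in>Pi\<^sub>E v ?T. arc_weight v (?c \<pi>)) =
      (\<Sum>\<pi>\<in>Pi\<^sub>E H ?T. weight (?c \<pi>))" .
  have "(\<Prod>v\<in>vertices H \<rho>. fact (d (g1 v)) * fact (d (g2 v)) * fact (d (g0 v))) =
      ((\<Prod>e\<in>edges H \<iota>. fact (\<gamma> e)) ^ 2 :: real)"
    using prod_vertices[of "\<lambda>h. fact (d h)"] prod_edges[of "\<lambda>e. fact (\<gamma> e)"] by (simp add: hdec_def)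
  then have 2: "(\<Prod>v\<in>vertices H \<rho>. 1 / (fact (d (g1 v)) * fact (d (g2 v)) * fact (d (g0 v)))) =
      (1 / (\<Prod>e\<in>edges H \<iota>. fact (\<gamma> e)) ^ 2 :: real)"
    by (simp add: prod_dividef)
  have "(\<Prod>v\<in>vertices H \<rho>.
      W_v (d (g1 v)) (d (g2 v)) (d (g0 v)) (x (edge (g1 v))) (x (edge (g2 v))) (x (edge (g0 v)))) =
    (\<Prod>v\<in>vertices H \<rho>. 1 / (fact (d (g1 v)) * fact (d (g2 v)) * fact (d (g0 v))) *
      (\<Sum>\<pi>\<in>Pi\<^sub>E v ?T. arc_weight v (?c \<pi>)))"
    by (intro prod.cong refl W_v_eq_sum_arc_weight)
  then show ?thesis unfolding prod.distrib 1 2 by simp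
qed

end

section \<open>From two permutations per edge to one\<close>

lemma bij_betw_multi_indices:
  assumes "\<eta> \<in> perms_of n"
  shows "bij_betw (\<lambda>y. y \<circ> inv \<eta>) (multi_indices n) (multi_indices n)"
proof (rule bij_betw_byWitness[where f' = "\<lambda>y. y \<circ> \<eta>"])
  have \<eta>: "\<eta> permutes {..<n}" using assms by (simp add: perms_of_def)
  have mem: "y \<circ> \<theta> \<in> multi_indices n" if "\<theta> permutes {..<n}" "y \<in> multi_indices n" for \<theta> y
  proof (unfold multi_indices_def, rule PiE_I)
    fix t
    show "(y \<circ> \<theta>) t \<in> {1, 2}" if "t \<in> {..<n}"
      using that \<open>y \<in> _\<close> permutes_in_image[OF \<open>\<theta> permutes _\<close>, of t] by (auto simp: multi_indices_def)
    \<comment> \<open>A permutation of \<open>{..<n}\<close> fixes t, so the default value outside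
      the index range survives the composition.\<close>
    show "(y \<circ> \<theta>) t = undefined" if "t \<notin> {..<n}"
      using that \<open>y \<in> _\<close> permutes_not_in[OF \<open>\<theta> permutes _\<close>, of t]
      by (auto simp: multi_indices_def PiE_def extensional_def)
  qed
  show "(\<lambda>y. y \<circ> inv \<eta>) ` multi_indices n \<subseteq> multi_indices n"
    "(\<lambda>y. y \<circ> \<eta>) ` multi_indices n \<subseteq> multi_indices n"
    using mem \<eta> permutes_inv[OF \<eta>] by blast+
qed (use assms in \<open>auto simp: perms_of_def comp_assoc permutes_inv_o\<close>)

lemma rev_perm_rev_perm: "rev_perm n \<circ> rev_perm n = id"
  by (auto simp: rev_perm_def fun_eq_iff)

text \<open>The substitution that expresses the permutation at the second half-edge of an edge
  through \<eta> at the first and an inserted \<sigma>. The reversal accounts for the strand order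
  turning round along the ribbon.\<close>

lemma bij_betw_perms_of:
  assumes "\<eta> \<in> perms_of n"
  shows "bij_betw (\<lambda>\<sigma>. \<eta> \<circ> (inv \<sigma> \<circ> rev_perm n)) (perms_of n) (perms_of n)"
proof (rule bij_betw_byWitness[where f' = "\<lambda>\<theta>. inv (inv \<eta> \<circ> (\<theta> \<circ> rev_perm n))"])
  have \<eta>: "\<eta> permutes {..<n}" and rev: "rev_perm n permutes {..<n}"
    using assms rev_perm by (auto simp: perms_of_def)
  show "\<forall>\<sigma>\<in>perms_of n. inv (inv \<eta> \<circ> (\<eta> \<circ> (inv \<sigma> \<circ> rev_perm n) \<circ> rev_perm n)) = \<sigma>"
  proof
    fix \<sigma> assume "\<sigma> \<in> perms_of n"
    then have \<sigma>: "\<sigma> permutes {..<n}" by (simp add: perms_of_def)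
    have "inv \<eta> \<circ> (\<eta> \<circ> (inv \<sigma> \<circ> rev_perm n) \<circ> rev_perm n) =
        (inv \<eta> \<circ> \<eta>) \<circ> inv \<sigma> \<circ> (rev_perm n \<circ> rev_perm n)"
      by (simp add: comp_assoc)
    then show "inv (inv \<eta> \<circ> (\<eta> \<circ> (inv \<sigma> \<circ> rev_perm n) \<circ> rev_perm n)) = \<sigma>"
      using permutes_inv_o[OF \<eta>] permutes_inv_inv[OF \<sigma>] by (simp add: rev_perm_rev_perm)
  qed
  show "\<forall>\<theta>\<in>perms_of n. \<eta> \<circ> (inv (inv (inv \<eta> \<circ> (\<theta> \<circ> rev_perm n))) \<circ> rev_perm n) = \<theta>"
  proof
    fix \<theta> assume "\<theta> \<in> perms_of n"
    then have "inv \<eta> \<circ> (\<theta> \<circ> rev_perm n) permutes {..<n}"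
      using \<eta> rev by (auto simp: perms_of_def intro!: permutes_compose permutes_inv)
    then have "inv (inv (inv \<eta> \<circ> (\<theta> \<circ> rev_perm n))) = inv \<eta> \<circ> (\<theta> \<circ> rev_perm n)"
      by (rule permutes_inv_inv)
    then have "\<eta> \<circ> (inv (inv (inv \<eta> \<circ> (\<theta> \<circ> rev_perm n))) \<circ> rev_perm n) =
        (\<eta> \<circ> inv \<eta>) \<circ> \<theta> \<circ> (rev_perm n \<circ> rev_perm n)"
      by (simp add: comp_assoc)
    then show "\<eta> \<circ> (inv (inv (inv \<eta> \<circ> (\<theta> \<circ> rev_perm n))) \<circ> rev_perm n) = \<theta>"
      using permutes_inv_o[OF \<eta>] by (simp add: rev_perm_rev_perm)
  qed
  show "(\<lambda>\<sigma>. \<eta> \<circ> (inv \<sigma> \<circ> rev_perm n)) ` perms_of n \<subseteq> perms_of n"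
    "(\<lambda>\<theta>. inv (inv \<eta> \<circ> (\<theta> \<circ> rev_perm n))) ` perms_of n \<subseteq> perms_of n"
    using \<eta> rev by (auto simp: perms_of_def intro!: permutes_compose permutes_inv)
qed

lemma card_perms_of: "card (perms_of n) = fact n"
  unfolding perms_of_def by (rule card_permutations) auto

context spin_network
begin

abbreviation "perm_families \<equiv> \<Pi>\<^sub>E e\<in>edges H \<iota>. perms_of (\<gamma> e)"
abbreviation "index_families \<equiv> \<Pi>\<^sub>E e\<in>edges H \<iota>. multi_indices (\<gamma> e)"

text \<open>At the representative half-edge the multi-index is read directly; at the other one it is
  read at the far end of the same strand. The colour is thus constant along the edge
  joining.\<close>

definition colouring :: "('d set \<Rightarrow> nat \<Rightarrow> nat) \<Rightarrow> ('d set \<Rightarrow> nat \<Rightarrow> nat) \<Rightarrow> 'd \<times> nat \<Rightarrow> nat" where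
  "colouring \<sigma> x = (\<lambda>(h, i). if h = edge_rep (edge h) then x (edge h) i
     else x (edge h) (inv (\<sigma> (edge h)) (d h - 1 - i)))"

lemma strand_perms_families: "\<sigma> \<in> perm_families \<Longrightarrow> strand_perms \<sigma>"
  by (auto simp: strand_perms_def perms_of_def)

definition join :: "('d set \<Rightarrow> nat \<Rightarrow> nat) \<Rightarrow> ('d set \<Rightarrow> nat \<Rightarrow> nat) \<Rightarrow> 'd \<Rightarrow> nat \<Rightarrow> nat" where
  "join \<eta> \<theta> = (\<lambda>h\<in>H. if h = edge_rep (edge h) then \<eta> (edge h) else \<theta> (edge h))"

lemma sum_half_edge_perms:
  "(\<Sum>\<pi>\<in>Pi\<^sub>E H (\<lambda>h. perms_of (d h)). F \<pi>) = (\<Sum>\<eta>\<in>perm_families. \<Sum>\<theta>\<in>perm_families. F (join \<eta> \<theta>))"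
  unfolding sum.cartesian_product
proof (rule sum.reindex_bij_witness[where
      j = "\<lambda>\<pi>. (\<lambda>e\<in>edges H \<iota>. \<pi> (edge_rep e), \<lambda>e\<in>edges H \<iota>. \<pi> (\<iota> (edge_rep e)))" and
      i = "\<lambda>(\<eta>, \<theta>). join \<eta> \<theta>"])
  note rep = edge_rep
  have \<iota>rep: "\<iota> (edge_rep e) \<in> H" "\<iota> (edge_rep e) \<noteq> edge_rep e" "d (\<iota> (edge_rep e)) = \<gamma> e"
    if "e \<in> edges H \<iota>" for e
    using rep[OF that] \<iota> d_\<iota> by auto
  fix \<pi> assume \<pi>: "\<pi> \<in> Pi\<^sub>E H (\<lambda>h. perms_of (d h))"
  show *: "(case (\<lambda>e\<in>edges H \<iota>. \<pi> (edge_rep e), \<lambda>e\<in>edges H \<iota>. \<pi> (\<iota> (edge_rep e))) of (\<eta>, \<theta>) \<Rightarrow> join \<eta> \<theta>) = \<pi>"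
  proof
    fix h
    show "(case (\<lambda>e\<in>edges H \<iota>. \<pi> (edge_rep e), \<lambda>e\<in>edges H \<iota>. \<pi> (\<iota> (edge_rep e))) of (\<eta>, \<theta>) \<Rightarrow> join \<eta> \<theta>) h = \<pi> h"
    proof (cases "h \<in> H")
      case True
      then show ?thesis using rep_cases[OF True] \<iota>[OF True] edge_in[OF True] by (auto simp: join_def)
    next
      case False
      then show ?thesis using PiE_arb[OF \<pi> False] by (simp add: join_def)
    qed
  qed
  show "(\<lambda>e\<in>edges H \<iota>. \<pi> (edge_rep e), \<lambda>e\<in>edges H \<iota>. \<pi> (\<iota> (edge_rep e))) \<in> perm_families \<times> perm_families"
    using PiE_mem[OF \<pi>] rep \<iota>rep by (auto simp: PiE_iff) (metis+)?
  show "(case (\<lambda>e\<in>edges H \<iota>. \<pi> (edge_rep e), \<lambda>e\<in>edges H \<iota>. \<pi> (\<iota> (edge_rep e))) of (\<eta>, \<theta>) \<Rightarrow> F (join \<eta> \<theta>)) = F \<pi>"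
    using * by simp
next
  fix b assume b: "b \<in> perm_families \<times> perm_families"
  then obtain \<eta> \<theta> where \<eta>: "b = (\<eta>, \<theta>)" "\<eta> \<in> perm_families" "\<theta> \<in> perm_families" by blast
  show "(case b of (\<eta>, \<theta>) \<Rightarrow> join \<eta> \<theta>) \<in> Pi\<^sub>E H (\<lambda>h. perms_of (d h))"
    using \<eta> edge_in by (auto simp: join_def PiE_iff hdec_def)
  have "join \<eta> \<theta> (edge_rep e) = \<eta> e" "join \<eta> \<theta> (\<iota> (edge_rep e)) = \<theta> e" if "e \<in> edges H \<iota>" for e
    using edge_rep[OF that] \<iota> by (auto simp: join_def)
  then show "(\<lambda>e\<in>edges H \<iota>. (case b of (\<eta>, \<theta>) \<Rightarrow> join \<eta> \<theta>) (edge_rep e),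
      \<lambda>e\<in>edges H \<iota>. (case b of (\<eta>, \<theta>) \<Rightarrow> join \<eta> \<theta>) (\<iota> (edge_rep e))) = b"
    using \<eta> PiE_arb[OF \<eta>(2)] PiE_arb[OF \<eta>(3)] by (auto simp: fun_eq_iff restrict_def)
qed

text \<open>For fixed \<eta> at the representatives, composing each multi-index with the inverse of
  \<eta> cancels \<eta> there, and the remaining permutation is rewritten through \<sigma>. The
  result does not depend on \<eta>, so summing over \<eta> only gives the product of
  factorials.\<close>

lemma sum_weight_half_edge_perms:
  "(\<Sum>x\<in>index_families. \<Sum>\<pi>\<in>Pi\<^sub>E H (\<lambda>h. perms_of (d h)). weight (\<lambda>(h, i). x (edge h) (\<pi> h i))) =
    (\<Prod>e\<in>edges H \<iota>. fact (\<gamma> e)) * (\<Sum>\<sigma>\<in>perm_families. \<Sum>x\<in>index_families. weight (colouring \<sigma> x))"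
proof -
  let ?w = "\<lambda>x \<eta> \<theta>. weight (\<lambda>(h, i). x (edge h) (join \<eta> \<theta> h i))"
  have "(\<Sum>x\<in>index_families. \<Sum>\<theta>\<in>perm_families. ?w x \<eta> \<theta>) =
      (\<Sum>\<sigma>\<in>perm_families. \<Sum>x\<in>index_families. weight (colouring \<sigma> x))" (is "_ = ?S")
    if \<eta>: "\<eta> \<in> perm_families" for \<eta>
  proof -
    let ?x = "\<lambda>x. \<lambda>e\<in>edges H \<iota>. x e \<circ> inv (\<eta> e)"
    let ?\<theta> = "\<lambda>\<sigma>. \<lambda>e\<in>edges H \<iota>. \<eta> e \<circ> (inv (\<sigma> e) \<circ> rev_perm (\<gamma> e))"
    have "(\<Sum>x\<in>index_families. \<Sum>\<theta>\<in>perm_families. ?w x \<eta> \<theta>) =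
        (\<Sum>x\<in>index_families. \<Sum>\<theta>\<in>perm_families. ?w (?x x) \<eta> \<theta>)"
      using \<eta> by (intro sum_PiE_bij_betw bij_betw_multi_indices) auto
    also have "\<dots> = (\<Sum>x\<in>index_families. \<Sum>\<sigma>\<in>perm_families. ?w (?x x) \<eta> (?\<theta> \<sigma>))"
      using \<eta> by (intro sum.cong[OF refl] sum_PiE_bij_betw bij_betw_perms_of) auto
    also have "\<dots> = (\<Sum>\<sigma>\<in>perm_families. \<Sum>x\<in>index_families. ?w (?x x) \<eta> (?\<theta> \<sigma>))"
      by (rule sum.swap)
    also have "\<dots> = ?S"
    proof (intro sum.cong refl weight_cong)
      fix \<sigma> x h i
      assume "\<sigma> \<in> perm_families" and hi: "h \<in> H" "i < d h"
      have e: "edge h \<in> edges H \<iota>" "\<gamma> (edge h) = d h" using edge_in hi by (auto simp: hdec_def)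
      then have "\<eta> (edge h) permutes {..<d h}" using PiE_mem[OF \<eta> e(1)] by (simp add: perms_of_def)
      then have "inv (\<eta> (edge h)) (\<eta> (edge h) j) = j" for j by (rule permutes_inverses)
      then show "(\<lambda>(h, i). ?x x (edge h) (join \<eta> (?\<theta> \<sigma>) h i)) (h, i) = colouring \<sigma> x (h, i)"
        using hi e by (simp add: join_def colouring_def rev_perm_def)
    qed
    finally show ?thesis .
  qed
  then have "(\<Sum>\<eta>\<in>perm_families. \<Sum>x\<in>index_families. \<Sum>\<theta>\<in>perm_families. ?w x \<eta> \<theta>) =
      of_nat (card perm_families) * (\<Sum>\<sigma>\<in>perm_families. \<Sum>x\<in>index_families. weight (colouring \<sigma> x))"
    by simp
  moreover have "of_nat (card perm_families) = (\<Prod>e\<in>edges H \<iota>. fact (\<gamma> e) :: real)"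
    using finite_edges by (simp add: card_PiE card_perms_of)
  moreover have "(\<Sum>x\<in>index_families. \<Sum>\<pi>\<in>Pi\<^sub>E H (\<lambda>h. perms_of (d h)). weight (\<lambda>(h, i). x (edge h) (\<pi> h i))) =
      (\<Sum>\<eta>\<in>perm_families. \<Sum>x\<in>index_families. \<Sum>\<theta>\<in>perm_families. ?w x \<eta> \<theta>)"
    unfolding sum_half_edge_perms by (rule sum.swap)
  ultimately show ?thesis by simp
qed


text \<open>A colouring with nonzero weight directs the curves: strands of colour 1 run along the
  orientation of their edge, strands of colour 2 against it.\<close>

definition forward :: "('d \<times> nat \<Rightarrow> nat) \<Rightarrow> ('d \<times> nat) set" where
  "forward c = {y \<in> P. (c y = 1) = out (fst y)}"

lemma prod_G:
  "(\<Prod>v\<in>vertices H \<rho>. \<Prod>i\<in>G_at v. f (g1 v, i)) = (\<Prod>y\<in>G. f y)"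
proof -
  have "inj_on (\<lambda>(v, i). (g1 v, i)) (Sigma (vertices H \<rho>) G_at)"
  proof (rule inj_onI, clarsimp)
    fix v w assume "v \<in> vertices H \<rho>" "w \<in> vertices H \<rho>" "g1 v = g1 w"
    then show "v = w" using vertex_unique vertex_mem by metis
  qed
  moreover have "finite (G_at v)" for v by (simp add: G_at_def)
  ultimately show ?thesis
    using finite_vertices by (simp add: G_def prod.Sigma prod.reindex case_prod_unfold)
qed

text \<open>The factor \<epsilon> requires different colours on a gate arc, where both ends have the
  same orientation; \<delta> requires equal colours on the other arcs, where the orientations
  differ. Both say that V exchanges \<open>forward c\<close> with its complement. A nonzero
  \<epsilon> is 1 exactly when the end at the first gate half-edge has colour 1, that is when it
  lies in both or neither of \<open>forward c\<close> and X.\<close>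

lemma weight_eq_turn_sign:
  assumes c: "\<And>y. y \<in> P \<Longrightarrow> c y \<in> {1, 2}"
  shows "weight c = (if alternating P V (forward c) then real_of_int (turn_sign (forward c)) else 0)"
proof -
  let ?S = "forward c"
  have VP: "V y \<in> P" "V (V y) = y" if "y \<in> P" for y using matchingD[OF matching_V that] by auto
  have S: "y \<in> ?S \<longleftrightarrow> (c y = 1) = out (fst y)" if "y \<in> P" for y
    using that by (simp add: forward_def)
  have g1P: "(g1 v, i) \<in> P" "out (fst (V (g1 v, i))) = out (g1 v)"
    if "v \<in> vertices H \<rho>" "i \<in> G_at v" for v i
    using that vertex_cases(2,4)[OF that(1)] by (auto simp: G_at_def P_iff)
  have g0P: "(g0 v, k) \<in> P" "out (fst (V (g0 v, k))) \<noteq> out (g0 v)"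
    if v: "v \<in> vertices H \<rho>" and "k < d (g0 v)" for v k
  proof -
    show "(g0 v, k) \<in> P" using that vertex_distinct(2)[OF v] by (simp add: P_iff)
    have "fst (V (g0 v, k)) \<in> v - {g0 v}" using fst_V[OF v] vertex_mem[OF v] by blast
    then show "out (fst (V (g0 v, k))) \<noteq> out (g0 v)"
      using vertex_mem[OF v] vertex_cases(4,5)[OF v] by auto
  qed
  show ?thesis
  proof (cases "alternating P V ?S")
    case True
    have alt: "V y \<in> ?S \<longleftrightarrow> y \<notin> ?S" if "y \<in> P" for y using alternatingD(2)[OF True that] .
    have "eps (c (g1 v, i)) (c (V (g1 v, i))) =
        (if ((g1 v, i) \<in> ?S) = ((g1 v, i) \<in> X) then 1 else -1)"
      if "v \<in> vertices H \<rho>" "i \<in> G_at v" for v i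
    proof -
      let ?y = "(g1 v, i)"
      note y = g1P[OF that]
      have "c (V ?y) = 1 \<longleftrightarrow> c ?y \<noteq> 1" using alt[OF y(1)] S[OF y(1)] S[OF VP(1)[OF y(1)]] y(2) by auto
      then show ?thesis
        using c[OF y(1)] c[OF VP(1)[OF y(1)]] S[OF y(1)] y(1) by (auto simp: eps_def X_def)
    qed
    moreover have "kdelta (c (g0 v, k)) (c (V (g0 v, k))) = 1"
      if "v \<in> vertices H \<rho>" "k < d (g0 v)" for v k
    proof -
      let ?y = "(g0 v, k)"
      note y = g0P[OF that]
      have "c (V ?y) = 1 \<longleftrightarrow> c ?y = 1" using alt[OF y(1)] S[OF y(1)] S[OF VP(1)[OF y(1)]] y(2) by auto
      then show ?thesis
        using c[OF y(1)] c[OF VP(1)[OF y(1)]] by (auto simp: kdelta_def)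
    qed
    ultimately have "weight c =
        (\<Prod>v\<in>vertices H \<rho>. \<Prod>i\<in>G_at v. if ((g1 v, i) \<in> ?S) = ((g1 v, i) \<in> X) then 1 else -1)"
      unfolding weight_def arc_weight_def by (intro prod.cong refl) simp
    also have "\<dots> = (\<Prod>y\<in>G. if (y \<in> ?S) = (y \<in> X) then 1 else -1)"
      by (rule prod_G)
    also have "\<dots> = real_of_int (turn_sign ?S)"
      unfolding turn_sign_def of_int_prod by (intro prod.cong) auto
    finally show ?thesis using True by simp
  next
    case False
    \<comment> \<open>An arc that violates alternation is bad at both ends, so it can be examined at
      the end that occurs in \<open>arc_weight\<close>: at the third half-edge if it meets it,
      otherwise at the first gate half-edge.\<close>
    define bad where "bad y \<longleftrightarrow> (V y \<in> ?S \<longleftrightarrow> y \<in> ?S)" for y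
    obtain y where y: "y \<in> P" "bad y"
      using False by (auto simp: alternating_def forward_def bad_def)
    have y': "V y \<in> P" "bad (V y)" "V (V y) = y" using y VP by (auto simp: bad_def)
    obtain h i where hi: "y = (h, i)" "h \<in> H" "i < d h" using y by (auto simp: strand_points_def)
    obtain h' i' where hi': "V y = (h', i')" by (cases "V y")
    have i': "i' < d h'" using y'(1) hi' by (simp add: P_iff)
    define v where "v = vertex_of \<rho> h"
    have v: "v \<in> vertices H \<rho>" "h \<in> v" using in_vertex hi by (auto simp: v_def)
    have h': "h' \<in> v" "h' \<noteq> h" using fst_V[OF v, of i] hi' hi by auto
    have "arc_weight v c = 0"
    proof (cases "h = g0 v \<or> h' = g0 v")
      case True
      then obtain k where k: "k < d (g0 v)" "bad (g0 v, k)"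
        using hi hi' i' y y' by metis
      let ?y = "(g0 v, k)"
      note z = g0P[OF v(1) k(1)]
      have "c (V ?y) \<noteq> c ?y"
        using k(2) S[OF z(1)] S[OF VP(1)[OF z(1)]] z(2) by (auto simp: bad_def)
      then have "(\<Prod>k<d (g0 v). kdelta (c (g0 v, k)) (c (V (g0 v, k)))) = 0"
        using k(1) by (intro prod_zero) (auto simp: kdelta_def intro!: bexI[of _ k])
      then show ?thesis by (simp add: arc_weight_def)
    next
      case False
      then have "h = g1 v \<and> h' = g2 v \<or> h = g2 v \<and> h' = g1 v"
        using v(2) h' vertex_mem[OF v(1)] by metis
      then obtain j where j: "j \<in> G_at v" "bad (g1 v, j)"
      proof
        assume *: "h = g1 v \<and> h' = g2 v"
        show ?thesis by (rule that[of i]) (use * hi hi' y in \<open>auto simp: G_at_def\<close>)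
      next
        assume *: "h = g2 v \<and> h' = g1 v"
        have "V (h', i') = (h, i)" using y'(3) hi hi' by simp
        then show ?thesis
          by (intro that[of i']) (use * hi hi' i' y' in \<open>auto simp: G_at_def\<close>)
      qed
      let ?y = "(g1 v, j)"
      note z = g1P[OF v(1) j(1)]
      have "c (V ?y) = 1 \<longleftrightarrow> c ?y = 1"
        using j(2) S[OF z(1)] S[OF VP(1)[OF z(1)]] z(2) by (auto simp: bad_def)
      then have "eps (c ?y) (c (V ?y)) = 0"
        using c[OF z(1)] c[OF VP(1)[OF z(1)]] by (auto simp: eps_def)
      moreover have "finite (G_at v)" by (simp add: G_at_def)
      ultimately have "(\<Prod>i\<in>G_at v. eps (c (g1 v, i)) (c (V (g1 v, i)))) = 0"
        using j(1) by (intro prod_zero) auto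
      then show ?thesis by (simp add: arc_weight_def)
    qed
    then have "weight c = 0"
      unfolding weight_def using v(1) finite_vertices by (intro prod_zero) auto
    then show ?thesis using False by simp
  qed
qed

lemma colouring_edge_match:
  assumes \<sigma>: "strand_perms \<sigma>" and y: "y \<in> P"
  shows "colouring \<sigma> x (edge_match \<iota> \<gamma> \<sigma> y) = colouring \<sigma> x y"
proof -
  obtain h i where hi: "y = (h, i)" "h \<in> H" "i < d h" using y by (auto simp: strand_points_def)
  note \<iota>h = \<iota>[OF hi(2)] and \<sigma>h = strand_permsD[OF \<sigma> hi(2)]
  have "\<sigma> (edge h) i < d h" using \<sigma>h(2) hi by simp
  then have rev: "d h - Suc (d h - Suc (\<sigma> (edge h) i)) = \<sigma> (edge h) i" by simp
  from rep_cases[OF hi(2)] show ?thesis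
  proof
    assume "edge_rep (edge h) = h"
    then show ?thesis
      using hi \<iota>h edge_\<iota>[OF hi(2)] d_\<iota>[OF hi(2)] \<sigma>h(5) rev by (simp add: colouring_def edge_match_eq)
  next
    assume "edge_rep (edge h) = \<iota> h"
    then show ?thesis
      using hi \<iota>h edge_\<iota>[OF hi(2)] d_\<iota>[OF hi(2)] by (simp add: colouring_def edge_match_eq)
  qed
qed

lemma colouring_range:
  assumes \<sigma>: "strand_perms \<sigma>" and x: "x \<in> index_families" and y: "y \<in> P"
  shows "colouring \<sigma> x y \<in> {1, 2}"
proof -
  obtain h i where hi: "y = (h, i)" "h \<in> H" "i < d h" using y by (auto simp: strand_points_def)
  have "x (edge h) \<in> multi_indices (d h)"
    using PiE_mem[OF x edge_in[OF hi(2)]] by (simp add: hdec_def)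
  then have xh: "x (edge h) j \<in> {1, 2}" if "j < d h" for j
    using that unfolding multi_indices_def by (auto dest: PiE_mem)
  have "inv (\<sigma> (edge h)) (d h - 1 - i) < d h"
    using strand_permsD(3)[OF \<sigma> hi(2)] hi(3) by simp
  then show ?thesis using hi xh by (simp only: colouring_def split: if_split) simp
qed

text \<open>Along an edge strand the colour persists while outgoing changes to incoming.\<close>

lemma alternating_forward:
  assumes \<sigma>: "strand_perms \<sigma>"
  shows "alternating P (edge_match \<iota> \<gamma> \<sigma>) (forward (colouring \<sigma> x))"
  unfolding alternating_def
proof (intro conjI ballI)
  show "forward (colouring \<sigma> x) \<subseteq> P" by (auto simp: forward_def)
  fix y assume y: "y \<in> P"
  have "edge_match \<iota> \<gamma> \<sigma> y \<in> P" by (rule matchingD[OF matching_edge_match[OF \<sigma>] y])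
  moreover have "fst (edge_match \<iota> \<gamma> \<sigma> y) = \<iota> (fst y)" by (cases y) (simp add: edge_match_eq)
  moreover have "fst y \<in> H" using y by (cases y) (simp add: P_iff)
  ultimately show "edge_match \<iota> \<gamma> \<sigma> y \<in> forward (colouring \<sigma> x) \<longleftrightarrow> y \<notin> forward (colouring \<sigma> x)"
    using y colouring_edge_match[OF \<sigma> y] out_\<iota> by (auto simp: forward_def)
qed

text \<open>Recovers the multi-indices from a direction by looking only at representative
  half-edges, where \<open>colouring\<close> does not involve \<sigma>.\<close>

definition indices :: "('d \<times> nat) set \<Rightarrow> 'd set \<Rightarrow> nat \<Rightarrow> nat" where
  "indices S = (\<lambda>e\<in>edges H \<iota>. \<lambda>i\<in>{..<\<gamma> e}. if ((edge_rep e, i) \<in> S) = out (edge_rep e) then 1 else 2)"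

lemma sum_weight_colouring:
  assumes \<sigma>: "strand_perms \<sigma>"
  shows "(\<Sum>x\<in>index_families. weight (colouring \<sigma> x)) =
    real_of_int (\<Sum>S | configuration (edge_match \<iota> \<gamma> \<sigma>) S. turn_sign S)"
proof -
  let ?E = "edge_match \<iota> \<gamma> \<sigma>" and ?f = "\<lambda>x. forward (colouring \<sigma> x)"
  note E = matching_edge_match[OF \<sigma>] alternating_edge_match[OF \<sigma>]
  have fin: "finite index_families"
    using finite_edges by (intro finite_PiE) (auto simp: multi_indices_def intro!: finite_PiE)
  have rep: "colouring \<sigma> x (edge_rep e, i) = x e i" if "e \<in> edges H \<iota>" for x e i
    using edge_rep[OF that] by (simp add: colouring_def)
  have repP: "(edge_rep e, i) \<in> P \<longleftrightarrow> i < \<gamma> e" if "e \<in> edges H \<iota>" for e i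
    using edge_rep[OF that] by (simp add: P_iff)
  have "(\<Sum>x\<in>index_families. weight (colouring \<sigma> x)) =
      (\<Sum>x\<in>index_families. if alternating P V (?f x) then real_of_int (turn_sign (?f x)) else 0)"
    by (intro sum.cong refl weight_eq_turn_sign colouring_range[OF \<sigma>])
  also have "\<dots> = (\<Sum>x\<in>{x \<in> index_families. alternating P V (?f x)}. real_of_int (turn_sign (?f x)))"
    using fin by (simp add: sum.inter_filter)
  also have "\<dots> = (\<Sum>S | configuration ?E S. real_of_int (turn_sign S))"
  proof (rule sum.reindex_bij_witness[where i = indices and j = ?f])
    fix x assume x: "x \<in> {x \<in> index_families. alternating P V (?f x)}"
    show "?f x \<in> {S. configuration ?E S}"
      using x E alternating_forward[OF \<sigma>] by (simp add: configuration_def)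
    show "indices (?f x) = x"
    proof
      fix e
      show "indices (?f x) e = x e"
      proof (cases "e \<in> edges H \<iota>")
        case True
        then have xe: "x e \<in> (\<Pi>\<^sub>E t\<in>{..<\<gamma> e}. {1, 2})" using x by (auto simp: multi_indices_def)
        show ?thesis
        proof
          fix i
          show "indices (?f x) e i = x e i"
          proof (cases "i < \<gamma> e")
            case i: True
            have "x e i \<in> {1, 2}" using PiE_mem[OF xe, of i] i by simp
            then show ?thesis
              using True i rep[OF True] repP[OF True] by (auto simp: indices_def forward_def)
          next
            case False
            then show ?thesis using True PiE_arb[OF xe, of i] by (simp add: indices_def)
          qed
        qed
      next
        case False
        then show ?thesis using x PiE_arb[of x _ _ e] by (auto simp: indices_def)
      qed
    qed
  next
    fix S assume "S \<in> {S. configuration ?E S}"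
    then have S: "alternating P V S" "alternating P ?E S" by (auto simp: configuration_def)
    show eq: "?f (indices S) = S"
    proof (rule set_eqI)
      fix y
      have sub: "S \<subseteq> P" "?f (indices S) \<subseteq> P" using S by (auto simp: alternating_def forward_def)
      have repS: "(edge_rep e, i) \<in> ?f (indices S) \<longleftrightarrow> (edge_rep e, i) \<in> S"
        if "e \<in> edges H \<iota>" "i < \<gamma> e" for e i
        using that rep[OF that(1)] repP[OF that(1)] by (auto simp: forward_def indices_def)
      show "y \<in> ?f (indices S) \<longleftrightarrow> y \<in> S"
      proof (cases "y \<in> P")
        case True
        then obtain h i where hi: "y = (h, i)" "h \<in> H" "i < d h" by (auto simp: strand_points_def)
        show ?thesis
        proof (cases "h = edge_rep (edge h)")
          case h: True
          then show ?thesis using repS[OF edge_in[OF hi(2)], of i] hi by (simp add: hdec_def)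
        next
          case False
          then have h: "edge_rep (edge h) = \<iota> h" using rep_cases[OF hi(2)] by auto
          obtain j where j: "?E y = (\<iota> h, j)" using hi by (auto simp: edge_match_eq)
          then have "j < \<gamma> (edge h)"
            using matchingD(1)[OF E(1) True] d_\<iota>[OF hi(2)] by (simp add: P_iff hdec_def)
          then have "?E y \<in> ?f (indices S) \<longleftrightarrow> ?E y \<in> S"
            using repS[OF edge_in[OF hi(2)]] h j by simp
          \<comment> \<open>At the other half-edge, membership is the negation of membership of the
            E-partner for both sets, and the partner sits on the representative.\<close>
          then show ?thesis
            using alternatingD(2)[OF S(2) True] alternatingD(2)[OF alternating_forward[OF \<sigma>] True]
            by blast
        qed
      qed (use sub in auto)
    qed
    have "indices S \<in> index_families"
      by (auto simp: indices_def multi_indices_def)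
    then show "indices S \<in> {x \<in> index_families. alternating P V (?f x)}" using eq S by simp
  qed simp
  finally show ?thesis by simp
qed

text \<open>The squared factorials in the denominator cancel against one factor in front and one
  from \<open>sum_weight_half_edge_perms\<close>.\<close>

lemma cg_sum_eq:
  "(\<Prod>e\<in>edges H \<iota>. fact (\<gamma> e)) * (\<Sum>x\<in>index_families. \<Prod>v\<in>vertices H \<rho>.
      W_v (d (g1 v)) (d (g2 v)) (d (g0 v)) (x (edge (g1 v))) (x (edge (g2 v))) (x (edge (g0 v)))) =
    (\<Sum>\<sigma>\<in>perm_families.
      real_of_int (\<Sum>S | configuration (edge_match \<iota> \<gamma> \<sigma>) S. turn_sign S))"
proof -
  have "(\<Prod>e\<in>edges H \<iota>. fact (\<gamma> e)) \<noteq> (0 :: real)"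
    using finite_edges by simp
  then show ?thesis
    using sum_weight_half_edge_perms sum_weight_colouring[OF strand_perms_families]
    by (simp add: prod_W_v sum_divide_distrib[symmetric] power2_eq_square)
qed

theorem penrose_eq_cg_eval:
  "\<exists>\<mu>\<in>{1, -1::real}.
    real_of_int (penrose H \<iota> \<rho> \<gamma> tc) =
      \<mu> * ((\<Prod>e\<in>edges H \<iota>. real (fact (\<gamma> e))) * (\<Prod>k<length tc. real (fact (tc ! k))))
        * cg_eval H \<iota> \<rho> \<gamma> tc out \<tau>"
proof -
obtain \<mu> where \<mu>: "\<mu> \<in> {1, -1}" and summand: "\<And>\<sigma>. strand_perms \<sigma> \<Longrightarrow>
      (\<Prod>e\<in>edges H \<iota>. sign (\<sigma> e)) * (-2) ^ graph_curves H \<iota> \<rho> \<gamma> \<sigma> =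
      \<mu> * (\<Sum>S | configuration (edge_match \<iota> \<gamma> \<sigma>) S. turn_sign S)"
    using penrose_term by blast
  let ?A = "\<Sum>\<sigma>\<in>perm_families. \<Sum>S | configuration (edge_match \<iota> \<gamma> \<sigma>) S. turn_sign S"
  let ?n = "\<Sum>k<length tc. tc ! k"
  \<comment> \<open>Curve counts of the graph part and of the trivial components add in the
    exponent, so the double sum is a product.\<close>
  have "penrose H \<iota> \<rho> \<gamma> tc =
      (\<Sum>\<sigma>\<in>perm_families. (\<Prod>e\<in>edges H \<iota>. sign (\<sigma> e)) * (-2) ^ graph_curves H \<iota> \<rho> \<gamma> \<sigma>) *
      (\<Sum>\<tau>\<in>(\<Pi>\<^sub>E k\<in>{..<length tc}. perms_of (tc ! k)).
        \<Prod>k<length tc. sign (\<tau> k) * (-2) ^ perm_cycles (tc ! k) (\<tau> k))"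
    unfolding penrose_def sum_product
    by (intro sum.cong refl) (simp add: power_add power_sum prod.distrib)
  also have "(\<Sum>\<sigma>\<in>perm_families. (\<Prod>e\<in>edges H \<iota>. sign (\<sigma> e)) * (-2) ^ graph_curves H \<iota> \<rho> \<gamma> \<sigma>) = \<mu> * ?A"
    by (subst sum_distrib_left) (intro sum.cong refl summand strand_perms_families)
  also have "(\<Sum>\<tau>\<in>(\<Pi>\<^sub>E k\<in>{..<length tc}. perms_of (tc ! k)).
        \<Prod>k<length tc. sign (\<tau> k) * (-2) ^ perm_cycles (tc ! k) (\<tau> k)) =
      (\<Prod>k<length tc. \<Sum>\<pi>\<in>perms_of (tc ! k). sign \<pi> * (-2) ^ perm_cycles (tc ! k) \<pi>)"
    by (rule prod_sum_PiE[symmetric]) (auto simp: perms_of_def finite_permutations)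
  also have "\<dots> = (-1) ^ ?n * (\<Prod>k<length tc. fact (tc ! k + 1))"
    by (simp only: sum_perms_sign_cycles prod.distrib power_sum)
  finally have "real_of_int (penrose H \<iota> \<rho> \<gamma> tc) =
      real_of_int (\<mu> * (-1) ^ ?n) * (real_of_int ?A * (\<Prod>k<length tc. fact (tc ! k + 1)))"
    by (simp add: mult_ac)
  \<comment> \<open>One factor is the edge factorial of the trivial component, the other its value
    in the Clebsch-Gordan evaluation.\<close>
  also have "(\<Prod>k<length tc. fact (tc ! k + 1)) =
      (\<Prod>k<length tc. real (fact (tc ! k))) * (\<Prod>k<length tc. real (tc ! k + 1))"
    by (simp add: prod.distrib[symmetric] algebra_simps)
  also have "real_of_int ?A = (\<Prod>e\<in>edges H \<iota>. real (fact (\<gamma> e))) *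
      (\<Sum>x\<in>index_families. \<Prod>v\<in>vertices H \<rho>.
        W_v (d (g1 v)) (d (g2 v)) (d (g0 v)) (x (edge (g1 v))) (x (edge (g2 v))) (x (edge (g0 v))))"
    using cg_sum_eq by simp
  finally have "real_of_int (penrose H \<iota> \<rho> \<gamma> tc) = real_of_int (\<mu> * (-1) ^ ?n) *
      ((\<Prod>e\<in>edges H \<iota>. real (fact (\<gamma> e))) * (\<Prod>k<length tc. real (fact (tc ! k)))) *
      cg_eval H \<iota> \<rho> \<gamma> tc out \<tau>"
    by (simp add: cg_eval_def Let_def mult_ac)
  moreover have "real_of_int (\<mu> * (-1) ^ ?n) \<in> {1, -1}"
    using \<mu> by (cases "even ?n") auto
  ultimately show ?thesis by blast
qed

end

theorem theorem4:
  fixes H :: "'d set" and \<iota> \<rho> :: "'d \<Rightarrow> 'd" and \<gamma> :: "'d set \<Rightarrow> nat" and tc :: "nat list"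
    and out :: "'d \<Rightarrow> bool" and \<tau> :: "'d set \<Rightarrow> 'd \<times> 'd"
  assumes "cubic_ribbon_graph H \<iota> \<rho>"
    and "admissible H \<iota> \<rho> \<gamma>"
    and "smooth_orientation H \<iota> \<rho> out"
    and "gate_signage H \<rho> out \<tau>"
  shows "\<exists>\<mu>\<in>{1, -1::real}.
    real_of_int (penrose H \<iota> \<rho> \<gamma> tc) =
      \<mu> * ((\<Prod>e\<in>edges H \<iota>. real (fact (\<gamma> e))) * (\<Prod>k<length tc. real (fact (tc ! k))))
        * cg_eval H \<iota> \<rho> \<gamma> tc out \<tau>"
  using spin_network.penrose_eq_cg_eval[OF spin_network.intro[OF assms]] .

end
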